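(* Let $u$ be the optimal control of the optimal control problem described in the context, with optimal state $y(u)$ and adjoint state $p(u)$. Then the majorant $\mathcal{M}^\oplus$ satisfies $$\inf_{\eta,\zeta\in V,\ \boldsymbol{\tau},\boldsymbol{\rho}\in H(\mathrm{div},\Omega),\ \alpha,\beta>0}\mathcal{M}^\oplus(\alpha,\beta;\eta,\zeta,\boldsymbol{\tau},\boldsymbol{\rho},v_\zeta)=0,$$ where $v_\zeta(\boldsymbol{x})=\min\{u_b(\boldsymbol{x}),\max\{u_a(\boldsymbol{x}),u_d(\boldsymbol{x})-\tfrac1\lambda\zeta(\boldsymbol{x})\}\}$ for a.e. $\boldsymbol{x}\in\Omega$. The infimum is attained on the exact solution $v_\zeta=u$, $\eta=y(u)$, $\zeta=p(u)$, $\boldsymbol{\tau}=\nu\nabla y(u)$, $\boldsymbol{\rho}=\nu\nabla p(u)$, in the sense that for these arguments $\inf_{\alpha,\beta>0}\mathcal{M}^\oplus(\alpha,\beta;y(u),p(u),\nu\nabla y(u),\nu\nabla p(u),u)=0$.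
   Context: Let $\Omega\subset\mathbb{R}^d$, $d\in\{1,2,3\}$, be a bounded Lipschitz domain, $V=H^1_0(\Omega)$, $y_d,u_d,f\in L^2(\Omega)$, $\lambda>0$. Let $\nu:\Omega\to\mathbb{R}$ be measurable with $0<\underline{\nu}\le\nu(\boldsymbol{x})\le\overline{\nu}$ for constants $\underline\nu,\overline\nu$. All functions are real valued; $\|\cdot\|$ is the $L^2(\Omega)$-norm (also for vector fields). $H(\mathrm{div},\Omega)=\{\boldsymbol{\tau}\in[L^2(\Omega)]^d:\mathrm{div}\,\boldsymbol{\tau}\in L^2(\Omega)\}$. $C_F>0$ is a Friedrichs constant: $\|w\|\le C_F\|\nabla w\|$ for all $w\in V$. For $v\in L^2(\Omega)$, $y(v)\in V$ is the weak solution of $\int_\Omega\nu\nabla y(v)\cdot\nabla w\,d\boldsymbol{x}=\int_\Omega(f+v)w\,d\boldsymbol{x}$ for all $w\in V$. The cost functional is $\mathcal{J}(y(v),v)=\frac12\|y(v)-y_d\|^2+\frac\lambda2\|v-u_d\|^2$. Admissible controls: $U_{\mathrm{ad}}=\{v\in L^2(\Omega):u_a\le v\le u_b\text{ a.e. in }\Omega\}$, where $u_a,u_b\in L^2(\Omega)$, $u_a\le u_b$ a.e. The optimal control $u$ is the unique minimizer of $v\mapsto\mathcal{J}(y(v),v)$ over $U_{\mathrm{ad}}$; equivalently, with $y=y(u)$ and the adjoint state $p=p(u)\in V$, the triple $(y,u,p)$ solves the optimality system consisting of the state equation for $y$ with control $u$, $\int_\Omega\nu\nabla p\cdot\nabla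 w\,d\boldsymbol{x}=\int_\Omega(y-y_d)w\,d\boldsymbol{x}$ for all $w\in V$, and $\int_\Omega(p+\lambda(u-u_d))(w-u)\,d\boldsymbol{x}\ge0$ for all $w\in U_{\mathrm{ad}}$. The majorant is $$\mathcal{M}^\oplus(\alpha,\beta;\eta,\zeta,\boldsymbol{\tau},\boldsymbol{\rho},v_\zeta)=\tfrac\alpha2\|\eta-y_d\|^2+\tfrac{(1+\alpha)(1+\beta)C_F^2}{2\alpha\underline\nu^2}\|\boldsymbol{\tau}-\nu\nabla\eta\|^2+\tfrac{(1+\alpha)(1+\beta)C_F^4}{2\alpha\beta\underline\nu^2}\|f+v_\zeta+\mathrm{div}\,\boldsymbol{\tau}\|^2$$ $$-\int_\Omega(f+v_\zeta+\mathrm{div}\,\boldsymbol{\tau})\zeta\,d\boldsymbol{x}-\int_\Omega(\boldsymbol{\tau}-\nu\nabla\eta)\cdot\nabla\zeta\,d\boldsymbol{x}$$ $$+\tfrac1{\underline\nu}\big(C_F\|\eta-y_d+\mathrm{div}\,\boldsymbol{\rho}\|+\|\boldsymbol{\rho}-\nu\nabla\zeta\|\big)\Big(\tfrac{C_F^3}{\lambda\underline\nu}\|\eta-y_d+\mathrm{div}\,\boldsymbol{\rho}\|+\tfrac{C_F^2}{\lambda\underline\nu}\|\boldsymbol{\rho}-\nu\nabla\zeta\|+C_F\|f+v_\zeta+\mathrm{div}\,\boldsymbol{\tau}\|+\|\boldsymbol{\tau}-\nu\nabla\eta\|\Big).$$ *)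

theory Defs
  imports "HOL-Analysis.Analysis"
begin

text \<open>Elements of the function spaces are represented by functions on the whole of
  \<open>real^'d\<close>; only their values on \<open>\<Omega>\<close> matter, and
  membership in \<open>L2\<close>, \<open>H1\<close>, \<open>H10\<close>, \<open>Hdiv\<close> does not depend on the representative chosen.\<close>

text \<open>Near each boundary point, \<open>\<Omega>\<close> is the strict epigraph, in some unit direction \<open>e\<close>, of a
  Lipschitz function \<open>\<gamma>\<close> on the hyperplane orthogonal to \<open>e\<close>.\<close>

definition lipschitz_domain :: "(real^'d) set \<Rightarrow> bool" where
  "lipschitz_domain \<Omega> \<longleftrightarrow> \<Omega> \<noteq> {} \<and> open \<Omega> \<and> connected \<Omega> \<and>
     (\<forall>x\<^sub>0 \<in> frontier \<Omega>. \<exists>r e L \<gamma>. r > 0 \<and> norm e = 1 \<and> L-lipschitz_on {z. z \<bullet> e = 0} \<gamma> \<and>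
        \<Omega> \<inter> ball x\<^sub>0 r = {x \<in> ball x\<^sub>0 r. \<gamma> (x - (x \<bullet> e) *\<^sub>R e) < x \<bullet> e})"

definition L2 :: "(real^'d) set \<Rightarrow> (real^'d \<Rightarrow> 'b::euclidean_space) set" where
  "L2 \<Omega> = {f. f \<in> borel_measurable (lebesgue_on \<Omega>) \<and>
                integrable (lebesgue_on \<Omega>) (\<lambda>x. (norm (f x))\<^sup>2)}"

definition L2norm :: "(real^'d) set \<Rightarrow> (real^'d \<Rightarrow> 'b::euclidean_space) \<Rightarrow> real" where
  "L2norm \<Omega> f = sqrt (LINT x|lebesgue_on \<Omega>. (norm (f x))\<^sup>2)"

primrec Ck :: "nat \<Rightarrow> (real^'d \<Rightarrow> real) \<Rightarrow> bool" where
  "Ck 0 f \<longleftrightarrow> continuous_on UNIV f"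
| "Ck (Suc k) f \<longleftrightarrow> (\<exists>g. (\<forall>x. GDERIV f x :> g x) \<and> (\<forall>i. Ck k (\<lambda>x. g x $ i)))"

definition test_functions :: "(real^'d) set \<Rightarrow> (real^'d \<Rightarrow> real) set" where
  "test_functions \<Omega> = {\<phi>. (\<forall>k. Ck k \<phi>) \<and>
     compact (closure {x. \<phi> x \<noteq> 0}) \<and> closure {x. \<phi> x \<noteq> 0} \<subseteq> \<Omega>}"

definition grad :: "(real^'d \<Rightarrow> real) \<Rightarrow> real^'d \<Rightarrow> real^'d" where
  "grad \<phi> x = (\<chi> i. frechet_derivative \<phi> (at x) (axis i 1))"

definition has_weak_grad ::
    "(real^'d) set \<Rightarrow> (real^'d \<Rightarrow> real) \<Rightarrow> (real^'d \<Rightarrow> real^'d) \<Rightarrow> bool" where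
  "has_weak_grad \<Omega> w g \<longleftrightarrow> g \<in> L2 \<Omega> \<and> (\<forall>\<phi> \<in> test_functions \<Omega>.
     (LINT x|lebesgue_on \<Omega>. w x *\<^sub>R grad \<phi> x) = - (LINT x|lebesgue_on \<Omega>. \<phi> x *\<^sub>R g x))"

definition has_weak_div ::
    "(real^'d) set \<Rightarrow> (real^'d \<Rightarrow> real^'d) \<Rightarrow> (real^'d \<Rightarrow> real) \<Rightarrow> bool" where
  "has_weak_div \<Omega> \<tau> g \<longleftrightarrow> g \<in> L2 \<Omega> \<and> (\<forall>\<phi> \<in> test_functions \<Omega>.
     (LINT x|lebesgue_on \<Omega>. \<tau> x \<bullet> grad \<phi> x) = - (LINT x|lebesgue_on \<Omega>. g x * \<phi> x))"

text \<open>Weak gradient and divergence are determined almost everywhere; the operators pick a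
  representative.\<close>

definition wgrad :: "(real^'d) set \<Rightarrow> (real^'d \<Rightarrow> real) \<Rightarrow> real^'d \<Rightarrow> real^'d" where
  "wgrad \<Omega> w = (SOME g. has_weak_grad \<Omega> w g)"

definition wdiv :: "(real^'d) set \<Rightarrow> (real^'d \<Rightarrow> real^'d) \<Rightarrow> real^'d \<Rightarrow> real" where
  "wdiv \<Omega> \<tau> = (SOME g. has_weak_div \<Omega> \<tau> g)"

definition H1 :: "(real^'d) set \<Rightarrow> (real^'d \<Rightarrow> real) set" where
  "H1 \<Omega> = {w \<in> L2 \<Omega>. \<exists>g. has_weak_grad \<Omega> w g}"

text \<open>The closure of the test functions in the norm of \<open>H1 \<Omega>\<close>.\<close>

definition H10 :: "(real^'d) set \<Rightarrow> (real^'d \<Rightarrow> real) set" where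
  "H10 \<Omega> = {w \<in> H1 \<Omega>. \<exists>\<phi>::nat \<Rightarrow> _. (\<forall>n. \<phi> n \<in> test_functions \<Omega>) \<and>
     (\<lambda>n. L2norm \<Omega> (\<lambda>x. \<phi> n x - w x)) \<longlonglongrightarrow> 0 \<and>
     (\<lambda>n. L2norm \<Omega> (\<lambda>x. grad (\<phi> n) x - wgrad \<Omega> w x)) \<longlonglongrightarrow> 0}"

definition Hdiv :: "(real^'d) set \<Rightarrow> (real^'d \<Rightarrow> real^'d) set" where
  "Hdiv \<Omega> = {\<tau> \<in> L2 \<Omega>. \<exists>g. has_weak_div \<Omega> \<tau> g}"

text \<open>Weak solution of \<open>- div (\<nu> \<nabla>y) = g\<close> with homogeneous Dirichlet conditions.\<close>

definition weak_solution ::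
    "(real^'d) set \<Rightarrow> (real^'d \<Rightarrow> real) \<Rightarrow> (real^'d \<Rightarrow> real) \<Rightarrow> (real^'d \<Rightarrow> real) \<Rightarrow> bool" where
  "weak_solution \<Omega> \<nu> g y \<longleftrightarrow> y \<in> H10 \<Omega> \<and> (\<forall>w \<in> H10 \<Omega>.
     (LINT x|lebesgue_on \<Omega>. \<nu> x * (wgrad \<Omega> y x \<bullet> wgrad \<Omega> w x)) =
     (LINT x|lebesgue_on \<Omega>. g x * w x))"

definition control_state ::
    "(real^'d) set \<Rightarrow> (real^'d \<Rightarrow> real) \<Rightarrow> (real^'d \<Rightarrow> real) \<Rightarrow> (real^'d \<Rightarrow> real) \<Rightarrow> real^'d \<Rightarrow> real"
  where
  "control_state \<Omega> \<nu> f v = (SOME y. weak_solution \<Omega> \<nu> (\<lambda>x. f x + v x) y)"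

definition cost ::
    "(real^'d) set \<Rightarrow> (real^'d \<Rightarrow> real) \<Rightarrow> (real^'d \<Rightarrow> real) \<Rightarrow> real
      \<Rightarrow> (real^'d \<Rightarrow> real) \<Rightarrow> (real^'d \<Rightarrow> real) \<Rightarrow> real" where
  "cost \<Omega> y\<^sub>d u\<^sub>d lam y v =
     1/2 * (L2norm \<Omega> (\<lambda>x. y x - y\<^sub>d x))\<^sup>2 + lam/2 * (L2norm \<Omega> (\<lambda>x. v x - u\<^sub>d x))\<^sup>2"

definition admissible_controls ::
    "(real^'d) set \<Rightarrow> (real^'d \<Rightarrow> real) \<Rightarrow> (real^'d \<Rightarrow> real) \<Rightarrow> (real^'d \<Rightarrow> real) set" where
  "admissible_controls \<Omega> u\<^sub>a u\<^sub>b =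
     {v \<in> L2 \<Omega>. AE x in lebesgue_on \<Omega>. u\<^sub>a x \<le> v x \<and> v x \<le> u\<^sub>b x}"

definition optimal_control ::
    "(real^'d) set \<Rightarrow> (real^'d \<Rightarrow> real) \<Rightarrow> (real^'d \<Rightarrow> real) \<Rightarrow> (real^'d \<Rightarrow> real)
      \<Rightarrow> (real^'d \<Rightarrow> real) \<Rightarrow> real \<Rightarrow> (real^'d \<Rightarrow> real) \<Rightarrow> (real^'d \<Rightarrow> real)
      \<Rightarrow> (real^'d \<Rightarrow> real) \<Rightarrow> bool" where
  "optimal_control \<Omega> \<nu> f y\<^sub>d u\<^sub>d lam u\<^sub>a u\<^sub>b u \<longleftrightarrow>
     is_arg_min (\<lambda>v. cost \<Omega> y\<^sub>d u\<^sub>d lam (control_state \<Omega> \<nu> f v) v)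
                (\<lambda>v. v \<in> admissible_controls \<Omega> u\<^sub>a u\<^sub>b) u"

definition projected_control ::
    "(real^'d \<Rightarrow> real) \<Rightarrow> real \<Rightarrow> (real^'d \<Rightarrow> real) \<Rightarrow> (real^'d \<Rightarrow> real)
      \<Rightarrow> (real^'d \<Rightarrow> real) \<Rightarrow> real^'d \<Rightarrow> real" where
  "projected_control u\<^sub>d lam u\<^sub>a u\<^sub>b \<zeta> x = min (u\<^sub>b x) (max (u\<^sub>a x) (u\<^sub>d x - 1/lam * \<zeta> x))"

text \<open>Here \<open>\<nu>l\<close> is the lower bound of the coefficient \<open>\<nu>\<close> and \<open>C\<close> a Friedrichs constant.\<close>

definition majorant ::
    "(real^'d) set \<Rightarrow> (real^'d \<Rightarrow> real) \<Rightarrow> real \<Rightarrow> real \<Rightarrow> real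
      \<Rightarrow> (real^'d \<Rightarrow> real) \<Rightarrow> (real^'d \<Rightarrow> real) \<Rightarrow> real \<Rightarrow> real
      \<Rightarrow> (real^'d \<Rightarrow> real) \<Rightarrow> (real^'d \<Rightarrow> real) \<Rightarrow> (real^'d \<Rightarrow> real^'d) \<Rightarrow> (real^'d \<Rightarrow> real^'d)
      \<Rightarrow> (real^'d \<Rightarrow> real) \<Rightarrow> real" where
  "majorant \<Omega> \<nu> \<nu>l C lam f y\<^sub>d \<alpha> \<beta> \<eta> \<zeta> \<tau> \<rho> v =
    (let r1 = (\<lambda>x. f x + v x + wdiv \<Omega> \<tau> x);
         r2 = (\<lambda>x. \<tau> x - \<nu> x *\<^sub>R wgrad \<Omega> \<eta> x);
         r3 = (\<lambda>x. \<eta> x - y\<^sub>d x + wdiv \<Omega> \<rho> x);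
         r4 = (\<lambda>x. \<rho> x - \<nu> x *\<^sub>R wgrad \<Omega> \<zeta> x)
     in \<alpha>/2 * (L2norm \<Omega> (\<lambda>x. \<eta> x - y\<^sub>d x))\<^sup>2
        + (1 + \<alpha>) * (1 + \<beta>) * C^2 / (2 * \<alpha> * \<nu>l^2) * (L2norm \<Omega> r2)\<^sup>2
        + (1 + \<alpha>) * (1 + \<beta>) * C^4 / (2 * \<alpha> * \<beta> * \<nu>l^2) * (L2norm \<Omega> r1)\<^sup>2
        - (LINT x|lebesgue_on \<Omega>. r1 x * \<zeta> x)
        - (LINT x|lebesgue_on \<Omega>. r2 x \<bullet> wgrad \<Omega> \<zeta> x)
        + 1/\<nu>l * (C * L2norm \<Omega> r3 + L2norm \<Omega> r4)
          * (C^3 / (lam * \<nu>l) * L2norm \<Omega> r3 + C^2 / (lam * \<nu>l) * L2norm \<Omega> r4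
             + C * L2norm \<Omega> r1 + L2norm \<Omega> r2))"

end

(* With e = y(v) - \<eta>, integration by parts bounds the energy of e by the residuals of \<tau>, and turns
   the two linear terms of the majorant into the energy product of e and \<zeta>. Completing squares,
   the majorant is bounded below by |e|^2/2 plus a square in the residuals of \<rho>, hence is nonnegative;
   at the exact solution all residuals vanish and it equals \<alpha>/2 |y - y_d|^2, which tends to 0
   with \<alpha>. Besides existence of weak solutions this needs that weak gradients and divergences are
   unique, i.e. the fundamental lemma of the calculus of variations. *)

theory Submission
  imports Defs
begin

section \<open>The space of square-integrable functions\<close>

text \<open>Optimality of \<open>u\<close> is given as minimality of the cost, whereas the infimum
  ties the control to \<zeta> through the projection. So the exact tuple becomes a competitor only
  after the first-order condition has been derived: differentiating the cost along segments of
  admissible controls gives a variational inequality, which forces the projection of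
  \<open>p\<close> to agree with \<open>u\<close> almost everywhere. This link matters for the upper
  bound; nonnegativity of the majorant holds for every square-integrable control, chosen
  independently of \<zeta>. Weak gradients, weak divergences and states are values of a choice
  operator. Linear identities between weak derivatives are therefore available only almost
  everywhere, and the state chosen for \<open>u\<close> need not be the given function
  \<open>y\<close>. This is why identities are carried through integrals, where null sets are
  invisible, and why functions are compared by a seminorm instead of being identified.\<close>

definition L2inner :: "(real^'d) set \<Rightarrow> (real^'d \<Rightarrow> 'b::euclidean_space) \<Rightarrow> (real^'d \<Rightarrow> 'b) \<Rightarrow> real" where
  "L2inner \<Omega> f g = (LINT x|lebesgue_on \<Omega>. f x \<bullet> g x)"

lemma L2_measurable: "f \<in> L2 \<Omega> \<Longrightarrow> f \<in> borel_measurable (lebesgue_on \<Omega>)"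
  by (simp add: L2_def)

lemma L2_dominated:
  assumes "g \<in> borel_measurable (lebesgue_on \<Omega>)" and "f \<in> L2 \<Omega>"
    and "AE x in lebesgue_on \<Omega>. norm (g x) \<le> norm (f x)"
  shows "g \<in> L2 \<Omega>"
proof -
  have "integrable (lebesgue_on \<Omega>) (\<lambda>x. (norm (f x))\<^sup>2)"
    using assms by (simp add: L2_def)
  then have "integrable (lebesgue_on \<Omega>) (\<lambda>x. (norm (g x))\<^sup>2)"
    by (rule Bochner_Integration.integrable_bound)
      (use assms in \<open>auto intro!: power_mono\<close>)
  then show ?thesis using assms by (simp add: L2_def)
qed

lemma L2_zero [simp]: "(\<lambda>x. 0) \<in> L2 \<Omega>"
  by (simp add: L2_def)

lemma L2_add:
  assumes "f \<in> L2 \<Omega>" and "g \<in> L2 \<Omega>"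
  shows "(\<lambda>x. f x + g x) \<in> L2 \<Omega>"
proof -
  have "(norm (a + b))\<^sup>2 \<le> 2 * (norm a)\<^sup>2 + 2 * (norm b)\<^sup>2" for a b :: 'b
  proof -
    have "(norm (a + b))\<^sup>2 \<le> (norm a + norm b)\<^sup>2"
      by (intro power_mono norm_triangle_ineq) auto
    also have "\<dots> \<le> 2 * (norm a)\<^sup>2 + 2 * (norm b)\<^sup>2"
      using zero_le_power2[of "norm a - norm b"] by (simp add: power2_eq_square algebra_simps)
    finally show ?thesis .
  qed
  moreover have "integrable (lebesgue_on \<Omega>) (\<lambda>x. 2 * (norm (f x))\<^sup>2 + 2 * (norm (g x))\<^sup>2)"
    using assms by (auto simp: L2_def)
  ultimately have "integrable (lebesgue_on \<Omega>) (\<lambda>x. (norm (f x + g x))\<^sup>2)"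
    using assms by (elim Bochner_Integration.integrable_bound) (auto simp: L2_def)
  then show ?thesis using assms by (auto simp: L2_def)
qed

lemma L2_scaleR: "f \<in> L2 \<Omega> \<Longrightarrow> (\<lambda>x. c *\<^sub>R f x) \<in> L2 \<Omega>"
  by (auto simp: L2_def power_mult_distrib)

lemma L2_mult: "f \<in> L2 \<Omega> \<Longrightarrow> (\<lambda>x. c * f x) \<in> L2 \<Omega>" for f :: "real^'d \<Rightarrow> real"
  using L2_scaleR[of f \<Omega> c] by simp

lemma L2_uminus: "f \<in> L2 \<Omega> \<Longrightarrow> (\<lambda>x. - f x) \<in> L2 \<Omega>"
  using L2_scaleR[of f \<Omega> "-1"] by simp

lemma L2_diff: "f \<in> L2 \<Omega> \<Longrightarrow> g \<in> L2 \<Omega> \<Longrightarrow> (\<lambda>x. f x - g x) \<in> L2 \<Omega>"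
  using L2_add[OF _ L2_uminus, of f \<Omega> g] by simp

lemma L2_abs: "f \<in> L2 \<Omega> \<Longrightarrow> (\<lambda>x. \<bar>f x\<bar>) \<in> L2 \<Omega>" for f :: "real^'d \<Rightarrow> real"
  by (auto simp: L2_def)

lemma L2_component: "f \<in> L2 \<Omega> \<Longrightarrow> (\<lambda>x. f x $ i) \<in> L2 \<Omega>"
  for f :: "real^'d \<Rightarrow> real^'n"
  by (rule L2_dominated[where f=f])
    (auto dest: L2_measurable simp: component_le_norm_cart
      intro!: borel_measurable_continuous_on[OF continuous_on_component])

lemma L2_bounded_mult:
  assumes "k \<in> borel_measurable (lebesgue_on \<Omega>)" and "f \<in> L2 \<Omega>"
    and "\<And>x. x \<in> \<Omega> \<Longrightarrow> \<bar>k x\<bar> \<le> B"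
  shows "(\<lambda>x. k x *\<^sub>R f x) \<in> L2 \<Omega>"
proof (rule L2_dominated[OF _ L2_scaleR[OF assms(2), of B]])
  show "(\<lambda>x. k x *\<^sub>R f x) \<in> borel_measurable (lebesgue_on \<Omega>)"
    using assms(1) L2_measurable[OF assms(2)] by measurable
  have "norm (k x *\<^sub>R f x) \<le> norm (B *\<^sub>R f x)" if "x \<in> \<Omega>" for x
    using assms(3)[OF that] by (auto intro!: mult_right_mono)
  then show "AE x in lebesgue_on \<Omega>. norm (k x *\<^sub>R f x) \<le> norm (B *\<^sub>R f x)"
    by (auto intro!: AE_I2 simp: space_restrict_space)
qed

section \<open>Inner product and seminorm on square-integrable functions\<close>

lemma L2_inner_integrable:
  assumes "f \<in> L2 \<Omega>" and "g \<in> L2 \<Omega>"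
  shows "integrable (lebesgue_on \<Omega>) (\<lambda>x. f x \<bullet> g x)"
proof (rule Bochner_Integration.integrable_bound)
  show "integrable (lebesgue_on \<Omega>) (\<lambda>x. (norm (f x))\<^sup>2 + (norm (g x))\<^sup>2)"
    using assms by (auto simp: L2_def)
  show "(\<lambda>x. f x \<bullet> g x) \<in> borel_measurable (lebesgue_on \<Omega>)"
    using assms by (auto simp: L2_def)
  have "\<bar>a \<bullet> b\<bar> \<le> (norm a)\<^sup>2 + (norm b)\<^sup>2" for a b :: 'b
  proof -
    have "\<bar>a \<bullet> b\<bar> \<le> norm a * norm b" by (rule Cauchy_Schwarz_ineq2)
    also have "\<dots> \<le> (norm a)\<^sup>2 + (norm b)\<^sup>2"
      using zero_le_power2[of "norm a - norm b"] zero_le_power2[of "norm a"] zero_le_power2[of "norm b"]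
      unfolding power2_diff by linarith
    finally show ?thesis .
  qed
  then show "AE x in lebesgue_on \<Omega>. norm (f x \<bullet> g x) \<le> norm ((norm (f x))\<^sup>2 + (norm (g x))\<^sup>2)"
    by (intro AE_I2) simp
qed

lemma L2inner_commute: "L2inner \<Omega> f g = L2inner \<Omega> g f"
  by (simp add: L2inner_def inner_commute)

lemma L2inner_add_left:
  assumes "f \<in> L2 \<Omega>" and "g \<in> L2 \<Omega>" and "h \<in> L2 \<Omega>"
  shows "L2inner \<Omega> (\<lambda>x. f x + g x) h = L2inner \<Omega> f h + L2inner \<Omega> g h"
  using assms by (simp add: L2inner_def inner_add_left L2_inner_integrable)

lemma L2inner_diff_left:
  assumes "f \<in> L2 \<Omega>" and "g \<in> L2 \<Omega>" and "h \<in> L2 \<Omega>"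
  shows "L2inner \<Omega> (\<lambda>x. f x - g x) h = L2inner \<Omega> f h - L2inner \<Omega> g h"
  using assms by (simp add: L2inner_def inner_diff_left L2_inner_integrable)

lemma L2inner_scaleR_left: "L2inner \<Omega> (\<lambda>x. c *\<^sub>R f x) g = c * L2inner \<Omega> f g"
  by (simp add: L2inner_def)

lemma L2inner_mult_left: "L2inner \<Omega> (\<lambda>x. c * f x) g = c * L2inner \<Omega> f g"
  for f :: "real^'d \<Rightarrow> real"
  using L2inner_scaleR_left[of \<Omega> c f g] by simp

lemma L2inner_minus_left: "L2inner \<Omega> (\<lambda>x. - f x) g = - L2inner \<Omega> f g"
  using L2inner_scaleR_left[of \<Omega> "-1" f g] by simp

lemma L2inner_add_right:
  assumes "f \<in> L2 \<Omega>" and "g \<in> L2 \<Omega>" and "h \<in> L2 \<Omega>"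
  shows "L2inner \<Omega> h (\<lambda>x. f x + g x) = L2inner \<Omega> h f + L2inner \<Omega> h g"
  using L2inner_add_left[OF assms] by (simp add: L2inner_commute)

lemma L2inner_scaleR_right: "L2inner \<Omega> g (\<lambda>x. c *\<^sub>R f x) = c * L2inner \<Omega> g f"
  using L2inner_scaleR_left[of \<Omega> c f g] by (simp add: L2inner_commute)

lemma L2inner_mult_right: "L2inner \<Omega> g (\<lambda>x. c * f x) = c * L2inner \<Omega> g f"
  for f :: "real^'d \<Rightarrow> real"
  using L2inner_scaleR_right[of \<Omega> g c f] by simp

lemma L2inner_cong_AE:
  assumes "AE x in lebesgue_on \<Omega>. f x = f' x" and "AE x in lebesgue_on \<Omega>. g x = g' x"
    and "f \<in> L2 \<Omega>" "f' \<in> L2 \<Omega>" "g \<in> L2 \<Omega>" "g' \<in> L2 \<Omega>"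
  shows "L2inner \<Omega> f g = L2inner \<Omega> f' g'"
  unfolding L2inner_def using assms
  by (intro integral_cong_AE borel_measurable_inner) (auto dest: L2_measurable)

lemma L2norm_nonneg [simp]: "0 \<le> L2norm \<Omega> f"
  by (simp add: L2norm_def)

lemma L2norm_power2: "(L2norm \<Omega> f)\<^sup>2 = L2inner \<Omega> f f"
  by (simp add: L2norm_def L2inner_def power2_norm_eq_inner)

lemma L2norm_zero [simp]: "L2norm \<Omega> (\<lambda>x. 0) = 0"
  by (simp add: L2norm_def)

lemma L2norm_scaleR: "L2norm \<Omega> (\<lambda>x. c *\<^sub>R f x) = \<bar>c\<bar> * L2norm \<Omega> f"
  by (simp add: L2norm_def power_mult_distrib real_sqrt_mult)

lemma L2norm_mult: "L2norm \<Omega> (\<lambda>x. c * f x) = \<bar>c\<bar> * L2norm \<Omega> f"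
  for f :: "real^'d \<Rightarrow> real"
  using L2norm_scaleR[of \<Omega> c f] by simp

lemma L2norm_minus_commute: "L2norm \<Omega> (\<lambda>x. f x - g x) = L2norm \<Omega> (\<lambda>x. g x - f x)"
  by (simp add: L2norm_def norm_minus_commute)

lemma L2norm_cong_AE:
  assumes "AE x in lebesgue_on \<Omega>. f x = f' x" and "f \<in> L2 \<Omega>" "f' \<in> L2 \<Omega>"
  shows "L2norm \<Omega> f = L2norm \<Omega> f'"
  by (rule power2_eq_imp_eq) (auto simp: L2norm_power2 intro!: L2inner_cong_AE assms)

lemma L2norm_mono:
  assumes "AE x in lebesgue_on \<Omega>. norm (f x) \<le> norm (g x)" and "f \<in> L2 \<Omega>" "g \<in> L2 \<Omega>"
  shows "L2norm \<Omega> f \<le> L2norm \<Omega> g"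
  unfolding L2norm_def using assms
  by (intro real_sqrt_le_mono integral_mono_AE) (auto simp: L2_def intro!: power_mono)

lemma L2norm_eq_0_AE:
  assumes "f \<in> L2 \<Omega>" and "L2norm \<Omega> f = 0"
  shows "AE x in lebesgue_on \<Omega>. f x = 0"
proof -
  have "(LINT x|lebesgue_on \<Omega>. (norm (f x))\<^sup>2) = 0"
    using assms(2) by (simp add: L2norm_def)
  then have "AE x in lebesgue_on \<Omega>. (norm (f x))\<^sup>2 = 0"
    using assms(1) by (subst (asm) integral_nonneg_eq_0_iff_AE) (auto simp: L2_def)
  then show ?thesis by simp
qed

lemma L2norm_add_power2:
  assumes "f \<in> L2 \<Omega>" and "g \<in> L2 \<Omega>"
  shows "(L2norm \<Omega> (\<lambda>x. f x + g x))\<^sup>2 = (L2norm \<Omega> f)\<^sup>2 + 2 * L2inner \<Omega> f g + (L2norm \<Omega> g)\<^sup>2"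
  using assms by (simp add: L2norm_power2 L2inner_add_left L2inner_add_right L2_add
    L2inner_commute[of \<Omega> g f])

text \<open>The squared norm of f + c g is a quadratic polynomial in c that is never negative, in
  particular not at its minimum.\<close>

lemma L2_Cauchy_Schwarz:
  assumes "f \<in> L2 \<Omega>" and "g \<in> L2 \<Omega>"
  shows "\<bar>L2inner \<Omega> f g\<bar> \<le> L2norm \<Omega> f * L2norm \<Omega> g"
proof -
  let ?a = "L2norm \<Omega> f" and ?b = "L2norm \<Omega> g" and ?i = "L2inner \<Omega> f g"
  have q: "0 \<le> ?a\<^sup>2 + 2 * (c * ?i) + c\<^sup>2 * ?b\<^sup>2" for c
    using zero_le_power2[of "L2norm \<Omega> (\<lambda>x. f x + c *\<^sub>R g x)"] assms
    by (simp add: L2norm_add_power2 L2_scaleR L2inner_scaleR_right L2norm_scaleR power_mult_distrib)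
  have "?i\<^sup>2 \<le> (?a * ?b)\<^sup>2"
  proof (cases "?b = 0")
    \<comment> \<open>\<open>L2norm\<close> is a seminorm: norm zero means zero almost everywhere,
      which still makes the inner product vanish.\<close>
    case True
    then have "AE x in lebesgue_on \<Omega>. g x = 0" using assms L2norm_eq_0_AE by blast
    then have "?i = L2inner \<Omega> f (\<lambda>x. 0)" by (intro L2inner_cong_AE) (use assms in auto)
    then show ?thesis by (simp add: L2inner_def)
  next
    case False
    then have "?b\<^sup>2 > 0" by simp
    \<comment> \<open>The polynomial is evaluated at its minimiser c = - ?i / ?b^2.\<close>
    moreover have "?a\<^sup>2 + 2 * (- ?i / ?b\<^sup>2 * ?i) + (- ?i / ?b\<^sup>2)\<^sup>2 * ?b\<^sup>2 = ?a\<^sup>2 - ?i\<^sup>2 / ?b\<^sup>2"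
      using False by (simp add: field_simps power2_eq_square)
    ultimately show ?thesis
      using q[of "- ?i / ?b\<^sup>2"] by (simp add: field_simps power_mult_distrib)
  qed
  then show ?thesis
    by (metis L2norm_nonneg abs_le_square_iff abs_mult abs_of_nonneg)
qed

lemma L2norm_triangle:
  assumes "f \<in> L2 \<Omega>" and "g \<in> L2 \<Omega>"
  shows "L2norm \<Omega> (\<lambda>x. f x + g x) \<le> L2norm \<Omega> f + L2norm \<Omega> g"
proof (rule power2_le_imp_le)
  show "(L2norm \<Omega> (\<lambda>x. f x + g x))\<^sup>2 \<le> (L2norm \<Omega> f + L2norm \<Omega> g)\<^sup>2"
    using L2_Cauchy_Schwarz[OF assms] by (simp add: L2norm_add_power2[OF assms] power2_sum)
qed simp

lemma tendsto_L2inner: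
  assumes "\<And>n. F n \<in> L2 \<Omega>" and "f \<in> L2 \<Omega>" and "g \<in> L2 \<Omega>"
    and "(\<lambda>n. L2norm \<Omega> (\<lambda>x. F n x - f x)) \<longlonglongrightarrow> 0"
  shows "(\<lambda>n. L2inner \<Omega> (F n) g) \<longlonglongrightarrow> L2inner \<Omega> f g"
proof -
  have "(\<lambda>n. L2inner \<Omega> (F n) g - L2inner \<Omega> f g) \<longlonglongrightarrow> 0"
  proof (rule Lim_null_comparison)
    show "\<forall>\<^sub>F n in sequentially. norm (L2inner \<Omega> (F n) g - L2inner \<Omega> f g)
        \<le> L2norm \<Omega> (\<lambda>x. F n x - f x) * L2norm \<Omega> g"
      using L2_Cauchy_Schwarz[OF L2_diff[OF assms(1,2)] assms(3)] assms
      by (auto simp: L2inner_diff_left intro!: always_eventually)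
    show "(\<lambda>n. L2norm \<Omega> (\<lambda>x. F n x - f x) * L2norm \<Omega> g) \<longlonglongrightarrow> 0"
      using tendsto_mult[OF assms(4) tendsto_const] by simp
  qed
  then show ?thesis by (simp add: LIM_zero_iff)
qed

section \<open>Completeness of L2 over sets of finite measure\<close>

lemma L2_of_bounded:
  assumes "\<Omega> \<in> lmeasurable" and "f \<in> borel_measurable (lebesgue_on \<Omega>)" and "\<And>x. norm (f x) \<le> B"
  shows "f \<in> L2 \<Omega>"
proof -
  interpret finite_measure "lebesgue_on \<Omega>"
    using assms(1) by (simp add: finite_measure_lebesgue_on)
  have "(norm (f x))\<^sup>2 \<le> B\<^sup>2" for x using assms(3)[of x] by (intro power_mono) auto
  then have "integrable (lebesgue_on \<Omega>) (\<lambda>x. (norm (f x))\<^sup>2)"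
    by (intro integrable_const_bound[of _ "B\<^sup>2"]) (use assms in auto)
  then show ?thesis using assms(2) by (simp add: L2_def)
qed

text \<open>The core of the Riesz-Fischer theorem. On a set of finite measure, Cauchy-Schwarz
  against the constant 1 bounds the L1 norms of the increments by a geometric series. Hence the sum
  of the increments has a finite integral and is finite almost everywhere, so the telescoping series
  converges absolutely there.\<close>

lemma L2_convergent_subseq:
  fixes F :: "nat \<Rightarrow> real^'d \<Rightarrow> 'b::euclidean_space"
  assumes "\<Omega> \<in> lmeasurable" and F: "\<And>n. F n \<in> L2 \<Omega>"
    and fast: "\<And>n. L2norm \<Omega> (\<lambda>x. F (Suc n) x - F n x) \<le> (1/2)^n"
  shows "AE x in lebesgue_on \<Omega>. convergent (\<lambda>n. F n x)"
proof -
  interpret finite_measure "lebesgue_on \<Omega>"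
    using assms(1) by (simp add: finite_measure_lebesgue_on)
  define h where "h n x = norm (F (Suc n) x - F n x)" for n x
  define c where "c = L2norm \<Omega> (\<lambda>x. 1 :: real)"
  have h: "h n \<in> L2 \<Omega>" for n
    unfolding h_def using L2_diff[OF F[of "Suc n"] F[of n]] by (auto simp: L2_def)
  have one: "(\<lambda>x. 1 :: real) \<in> L2 \<Omega>"
    by (rule L2_of_bounded[OF assms(1), where B=1]) auto
  have int: "integrable (lebesgue_on \<Omega>) (h n)" for n
    using L2_inner_integrable[OF h[of n] one] by simp
  have "(LINT x|lebesgue_on \<Omega>. h n x) \<le> (1/2)^n * c" for n
  proof -
    have "(LINT x|lebesgue_on \<Omega>. h n x) \<le> L2norm \<Omega> (h n) * c"
      using L2_Cauchy_Schwarz[OF h[of n] one] by (simp add: L2inner_def c_def)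
    also have "L2norm \<Omega> (h n) = L2norm \<Omega> (\<lambda>x. F (Suc n) x - F n x)"
      by (simp add: L2norm_def h_def)
    also have "\<dots> * c \<le> (1/2)^n * c" by (rule mult_right_mono[OF fast]) (simp add: c_def)
    finally show ?thesis .
  qed
  moreover have "(\<integral>\<^sup>+x. ennreal (h n x) \<partial>lebesgue_on \<Omega>)
      = ennreal (LINT x|lebesgue_on \<Omega>. h n x)" for n
    by (intro nn_integral_eq_integral int) (auto simp: h_def)
  ultimately have le: "(\<integral>\<^sup>+x. ennreal (h n x) \<partial>lebesgue_on \<Omega>) \<le> ennreal ((1/2)^n * c)" for n
    by (simp add: ennreal_leI)
  have "(\<integral>\<^sup>+x. (\<Sum>n. ennreal (h n x)) \<partial>lebesgue_on \<Omega>)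
      = (\<Sum>n. \<integral>\<^sup>+x. ennreal (h n x) \<partial>lebesgue_on \<Omega>)"
    using int by (intro nn_integral_suminf) auto
  also have "\<dots> \<le> (\<Sum>n. ennreal ((1/2)^n * c))"
    by (intro suminf_le le) auto
  also have "\<dots> = ennreal (\<Sum>n. (1/2)^n * c)"
    by (intro suminf_ennreal2) (auto simp: c_def intro!: summable_mult2 summable_geometric)
  also have "\<dots> < \<infinity>" by simp
  finally have "AE x in lebesgue_on \<Omega>. (\<Sum>n. ennreal (h n x)) \<noteq> \<infinity>"
    using int by (intro nn_integral_PInf_AE) auto
  then show ?thesis
  proof (rule AE_mp, intro AE_I2 impI)
    fix x assume "(\<Sum>n. ennreal (h n x)) \<noteq> \<infinity>"
    then have "summable (\<lambda>n. h n x)"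
      by (intro summable_suminf_not_top) (auto simp: h_def)
    then have "summable (\<lambda>n. F (Suc n) x - F n x)"
      unfolding h_def by (rule summable_norm_cancel)
    then have "convergent (\<lambda>n. F n x - F 0 x)"
      by (simp add: summable_iff_convergent sum_lessThan_telescope[where f="\<lambda>n. F n x"])
    then have "convergent (\<lambda>n. (F n x - F 0 x) + F 0 x)"
      by (intro convergent_add convergent_const)
    then show "convergent (\<lambda>n. F n x)" by simp
  qed
qed

text \<open>Fatou's lemma for the squared norms; membership of the limit in \<open>L2\<close> is
  part of the conclusion. The bound is asked for only eventually because it will come from a Cauchy
  condition.\<close>

lemma L2_Fatou:
  fixes F :: "nat \<Rightarrow> real^'d \<Rightarrow> 'b::euclidean_space"
  assumes F: "\<And>n. F n \<in> L2 \<Omega>" and f: "f \<in> borel_measurable (lebesgue_on \<Omega>)"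
    and lim: "AE x in lebesgue_on \<Omega>. (\<lambda>n. F n x) \<longlonglongrightarrow> f x"
    and bd: "\<forall>\<^sub>F n in sequentially. L2norm \<Omega> (F n) \<le> e"
  shows "f \<in> L2 \<Omega>" and "L2norm \<Omega> f \<le> e"
proof -
  have [measurable]: "F n \<in> borel_measurable (lebesgue_on \<Omega>)" for n using F by (rule L2_measurable)
  note f[measurable]
  have "e \<ge> 0" using bd by (meson L2norm_nonneg eventually_sequentially le_refl order_trans)
  have nn: "(\<integral>\<^sup>+x. ennreal ((norm (g x))\<^sup>2) \<partial>lebesgue_on \<Omega>) = ennreal ((L2norm \<Omega> g)\<^sup>2)"
    if "g \<in> L2 \<Omega>" for g :: "real^'d \<Rightarrow> 'b"
    using that unfolding L2_def L2norm_def
    by (subst nn_integral_eq_integral) auto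
  have "(\<integral>\<^sup>+x. ennreal ((norm (f x))\<^sup>2) \<partial>lebesgue_on \<Omega>)
      \<le> (\<integral>\<^sup>+x. liminf (\<lambda>n. ennreal ((norm (F n x))\<^sup>2)) \<partial>lebesgue_on \<Omega>)"
  proof (rule nn_integral_mono_AE, rule AE_mp[OF lim], intro AE_I2 impI)
    fix x assume "(\<lambda>n. F n x) \<longlonglongrightarrow> f x"
    then have "(\<lambda>n. ennreal ((norm (F n x))\<^sup>2)) \<longlonglongrightarrow> ennreal ((norm (f x))\<^sup>2)"
      by (intro tendsto_ennrealI tendsto_power tendsto_norm)
    then show "ennreal ((norm (f x))\<^sup>2) \<le> liminf (\<lambda>n. ennreal ((norm (F n x))\<^sup>2))"
      using lim_imp_Liminf[OF sequentially_bot] by (metis order_refl)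
  qed
  also have "\<dots> \<le> liminf (\<lambda>n. \<integral>\<^sup>+x. ennreal ((norm (F n x))\<^sup>2) \<partial>lebesgue_on \<Omega>)"
    by (rule nn_integral_liminf) measurable
  also have "\<dots> = liminf (\<lambda>n. ennreal ((L2norm \<Omega> (F n))\<^sup>2))"
    by (simp add: nn[OF F])
  also have "\<dots> \<le> limsup (\<lambda>n. ennreal ((L2norm \<Omega> (F n))\<^sup>2))"
    by (rule Liminf_le_Limsup) simp
  also have "\<dots> \<le> ennreal (e\<^sup>2)"
    using bd by (intro Limsup_bounded) (auto elim!: eventually_mono intro!: ennreal_leI power_mono)
  finally have le: "(\<integral>\<^sup>+x. ennreal ((norm (f x))\<^sup>2) \<partial>lebesgue_on \<Omega>) \<le> ennreal (e\<^sup>2)" .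
  then have "integrable (lebesgue_on \<Omega>) (\<lambda>x. (norm (f x))\<^sup>2)"
    by (intro integrableI_bounded) (auto simp: less_top[symmetric] top_unique)
  then show mem: "f \<in> L2 \<Omega>" using f by (simp add: L2_def)
  have "(L2norm \<Omega> f)\<^sup>2 \<le> e\<^sup>2" using le by (simp add: nn[OF mem])
  then show "L2norm \<Omega> f \<le> e" using \<open>e \<ge> 0\<close> by (rule power2_le_imp_le)
qed

lemma L2_complete:
  fixes F :: "nat \<Rightarrow> real^'d \<Rightarrow> 'b::euclidean_space"
  assumes "\<Omega> \<in> lmeasurable" and F: "\<And>n. F n \<in> L2 \<Omega>"
    and Cauchy: "\<And>e. e > 0 \<Longrightarrow> \<exists>N. \<forall>m\<ge>N. \<forall>n\<ge>N. L2norm \<Omega> (\<lambda>x. F m x - F n x) \<le> e"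
  obtains f where "f \<in> L2 \<Omega>" and "(\<lambda>n. L2norm \<Omega> (\<lambda>x. F n x - f x)) \<longlonglongrightarrow> 0"
proof -
  have "\<exists>N. \<forall>m\<ge>N. \<forall>n\<ge>N. L2norm \<Omega> (\<lambda>x. F m x - F n x) \<le> (1/2)^k" for k
    by (rule Cauchy) simp
  then obtain N where N: "\<And>k m n. m \<ge> N k \<Longrightarrow> n \<ge> N k \<Longrightarrow> L2norm \<Omega> (\<lambda>x. F m x - F n x) \<le> (1/2)^k"
    by metis
  \<comment> \<open>The sum makes both \<open>r k\<close> and \<open>r (Suc k)\<close> at least
    \<open>N k\<close>, so consecutive members of the subsequence are within \<open>(1/2)^k\<close>;
    the summand \<open>k\<close> makes \<open>r\<close> tend to infinity.\<close>
  define r where "r k = k + (\<Sum>j\<le>k. N j)" for k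
  have le_sum: "N k \<le> (\<Sum>j\<le>k. N j)" for k by (rule member_le_sum) auto
  have r_ge: "r k \<ge> N k" "r k \<ge> k" "r (Suc k) \<ge> N k" for k
    using le_sum[of k] by (simp_all add: r_def)
  have "AE x in lebesgue_on \<Omega>. convergent (\<lambda>k. F (r k) x)"
    using assms(1) F N r_ge by (intro L2_convergent_subseq) auto
  \<comment> \<open>Where the subsequence diverges, \<open>lim\<close> has an arbitrary value; that
    happens on a null set only.\<close>
  moreover define f where "f x = lim (\<lambda>k. F (r k) x)" for x
  ultimately have lim: "AE x in lebesgue_on \<Omega>. (\<lambda>k. F (r k) x) \<longlonglongrightarrow> f x"
    by (simp add: convergent_LIMSEQ_iff f_def)
  have [measurable]: "F n \<in> borel_measurable (lebesgue_on \<Omega>)" for n using F by (rule L2_measurable)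
  have [measurable]: "f \<in> borel_measurable (lebesgue_on \<Omega>)"
    unfolding f_def[abs_def] by (rule borel_measurable_lim_metric) measurable
  have *: "\<exists>N. \<forall>n\<ge>N. (\<lambda>x. f x - F n x) \<in> L2 \<Omega> \<and> L2norm \<Omega> (\<lambda>x. f x - F n x) \<le> e"
    if "e > 0" for e
  proof -
    obtain M where M: "\<And>m n. m \<ge> M \<Longrightarrow> n \<ge> M \<Longrightarrow> L2norm \<Omega> (\<lambda>x. F m x - F n x) \<le> e"
      using Cauchy[OF \<open>e > 0\<close>] by metis
    have "(\<lambda>x. f x - F n x) \<in> L2 \<Omega> \<and> L2norm \<Omega> (\<lambda>x. f x - F n x) \<le> e" if "n \<ge> M" for n
    proof -
      \<comment> \<open>For fixed \<open>n\<close>, the Cauchy estimate passes to the limit along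
        the subsequence, although only pointwise convergence is known so far.\<close>
      note fat = L2_Fatou[where F = "\<lambda>k x. F (r k) x - F n x" and f = "\<lambda>x. f x - F n x" and \<Omega>=\<Omega> and e=e]
      have 1: "AE x in lebesgue_on \<Omega>. (\<lambda>k. F (r k) x - F n x) \<longlonglongrightarrow> f x - F n x"
        using lim by (auto elim!: eventually_mono intro!: tendsto_diff)
      have 2: "\<forall>\<^sub>F k in sequentially. L2norm \<Omega> (\<lambda>x. F (r k) x - F n x) \<le> e"
        using M r_ge(2) \<open>n \<ge> M\<close> by (intro eventually_sequentiallyI[of M]) (meson order_trans)
      show ?thesis by (intro conjI fat[OF L2_diff[OF F F] _ 1 2]) measurable
    qed
    then show ?thesis by blast
  qed
  obtain n where "(\<lambda>x. f x - F n x) \<in> L2 \<Omega>" using *[of 1] by auto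
  then have "f \<in> L2 \<Omega>" using L2_add[OF _ F[of n]] by fastforce
  moreover have "(\<lambda>n. L2norm \<Omega> (\<lambda>x. F n x - f x)) \<longlonglongrightarrow> 0"
  proof (rule LIMSEQ_I)
    fix e :: real assume "e > 0"
    then obtain N where "\<forall>n\<ge>N. L2norm \<Omega> (\<lambda>x. f x - F n x) \<le> e/2" using *[of "e/2"] by auto
    moreover have "L2norm \<Omega> (\<lambda>x. F n x - f x) = L2norm \<Omega> (\<lambda>x. f x - F n x)" for n
      by (rule L2norm_minus_commute)
    ultimately show "\<exists>N. \<forall>n\<ge>N. norm (L2norm \<Omega> (\<lambda>x. F n x - f x) - 0) < e"
      using \<open>e > 0\<close> by (intro exI[of _ N]) fastforce
  qed
  ultimately show ?thesis using that by blast
qed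

section \<open>Test functions\<close>

text \<open>Needed for products: the derivative of a product contains the undifferentiated factors,
  which are given at level \<open>Suc k\<close> and wanted at level \<open>k\<close>.\<close>

lemma Ck_of_Suc: "Ck (Suc k) f \<Longrightarrow> Ck k f"
proof (induction k arbitrary: f)
  case 0
  then obtain g where "\<And>x. GDERIV f x :> g x" by auto
  then have "continuous_on UNIV f"
    unfolding gderiv_def by (meson has_derivative_continuous continuous_at_imp_continuous_on)
  then show ?case by simp
next
  case (Suc k)
  obtain g where "\<forall>x. GDERIV f x :> g x" "\<forall>i. Ck (Suc k) (\<lambda>x. g x $ i)"
    using Suc.prems unfolding Ck.simps(2)[of "Suc k"] by blast
  then show ?case using Suc.IH by auto
qed

lemma Ck_const: "Ck k (\<lambda>x::real^'d. c)"
proof (induction k arbitrary: c)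
  case (Suc k)
  have "Ck k (\<lambda>x::real^'d. (0 :: real^'d) $ i)" for i using Suc[of 0] by simp
  then show ?case by (auto intro!: exI[of _ "\<lambda>x. 0"] GDERIV_const)
qed simp

lemma Ck_add: "Ck k f \<Longrightarrow> Ck k g \<Longrightarrow> Ck k (\<lambda>x. f x + g x)"
proof (induction k arbitrary: f g)
  case 0
  then show ?case by (auto intro: continuous_on_add)
next
  case (Suc k)
  obtain F where F: "\<forall>x. GDERIV f x :> F x" "\<forall>i. Ck k (\<lambda>x. F x $ i)" using Suc.prems(1) by auto
  obtain G where G: "\<forall>x. GDERIV g x :> G x" "\<forall>i. Ck k (\<lambda>x. G x $ i)" using Suc.prems(2) by auto
  show ?case using F G Suc.IH
    by (auto intro!: exI[of _ "\<lambda>x. F x + G x"] GDERIV_add)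
qed

lemma Ck_mult: "Ck k f \<Longrightarrow> Ck k g \<Longrightarrow> Ck k (\<lambda>x. f x * g x)"
proof (induction k arbitrary: f g)
  case 0
  then show ?case by (auto intro: continuous_on_mult)
next
  case (Suc k)
  obtain F where F: "\<forall>x. GDERIV f x :> F x" "\<forall>i. Ck k (\<lambda>x. F x $ i)" using Suc.prems(1) by auto
  obtain G where G: "\<forall>x. GDERIV g x :> G x" "\<forall>i. Ck k (\<lambda>x. G x $ i)" using Suc.prems(2) by auto
  have "Ck k f" "Ck k g" using Suc.prems Ck_of_Suc by blast+
  then have "Ck k (\<lambda>x. (f x *\<^sub>R G x + g x *\<^sub>R F x) $ i)" for i
    using F(2) G(2) Suc.IH by (simp add: Ck_add)
  then show ?case using F(1) G(1)
    by (auto intro!: exI[of _ "\<lambda>x. f x *\<^sub>R G x + g x *\<^sub>R F x"] GDERIV_mult)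
qed

lemma Ck_prod: "(\<And>i. i \<in> I \<Longrightarrow> Ck k (f i)) \<Longrightarrow> Ck k (\<lambda>x. \<Prod>i\<in>I. f i x)"
  by (induction I rule: infinite_finite_induct) (auto intro: Ck_const Ck_mult)

lemma grad_eq: "GDERIV f x :> D \<Longrightarrow> grad f x = D"
  unfolding gderiv_def
  by (auto simp: grad_def vec_eq_iff inner_axis' dest!: frechet_derivative_at[symmetric])

lemma Ck_GDERIV_grad: "Ck (Suc k) f \<Longrightarrow> GDERIV f x :> grad f x"
  using grad_eq unfolding Ck.simps(2) by metis

lemma Ck_grad:
  assumes "Ck (Suc k) f"
  shows "Ck k (\<lambda>x. grad f x $ i)"
proof -
  obtain F where F: "\<forall>x. GDERIV f x :> F x" "\<forall>i. Ck k (\<lambda>x. F x $ i)" using assms by auto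
  then have "grad f = F" by (auto simp: grad_eq)
  then show ?thesis using F by simp
qed

section \<open>Closure properties and bounds of test functions\<close>

lemma test_functionsI:
  assumes "\<And>k. Ck k \<phi>" and "compact K" and "K \<subseteq> \<Omega>" and "\<And>x. x \<notin> K \<Longrightarrow> \<phi> x = 0"
  shows "\<phi> \<in> test_functions \<Omega>"
proof -
  have sub: "closure {x. \<phi> x \<noteq> 0} \<subseteq> K"
    using assms by (intro closure_minimal) (auto simp: compact_imp_closed)
  moreover have "compact (closure {x. \<phi> x \<noteq> 0})"
    using sub assms(2) by (meson bounded_subset compact_eq_bounded_closed closed_closure)
  ultimately show ?thesis using assms by (auto simp: test_functions_def)
qed

text \<open>The gradient vanishes off the same compact set, because the complement of the support is
  open and the function is constantly 0 there.\<close>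

lemma test_functionsE:
  assumes "\<phi> \<in> test_functions \<Omega>"
  obtains K where "compact K" and "K \<subseteq> \<Omega>" and "\<And>x. x \<notin> K \<Longrightarrow> \<phi> x = 0"
    and "\<And>x. x \<notin> K \<Longrightarrow> grad \<phi> x = 0"
proof
  let ?K = "closure {x. \<phi> x \<noteq> 0}"
  show "compact ?K" "?K \<subseteq> \<Omega>" using assms by (auto simp: test_functions_def)
  show z: "\<phi> x = 0" if "x \<notin> ?K" for x using that closure_subset[of "{x. \<phi> x \<noteq> 0}"] by auto
  show "grad \<phi> x = 0" if "x \<notin> ?K" for x
  proof (rule grad_eq)
    have d: "((\<lambda>x. 0) has_derivative (\<lambda>h. h \<bullet> 0)) (at x)" by simp
    have "open (- ?K)" "x \<in> - ?K" using that by auto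
    moreover have "0 = \<phi> y" if "y \<in> - ?K" for y using z[of y] that by simp
    ultimately show "GDERIV \<phi> x :> 0"
      unfolding gderiv_def by (rule has_derivative_transform_within_open[OF d, where s = "- ?K"])
  qed
qed

lemma test_Ck: "\<phi> \<in> test_functions \<Omega> \<Longrightarrow> Ck k \<phi>"
  by (simp add: test_functions_def)

lemma test_GDERIV: "\<phi> \<in> test_functions \<Omega> \<Longrightarrow> GDERIV \<phi> x :> grad \<phi> x"
  by (rule Ck_GDERIV_grad[OF test_Ck])

lemma test_continuous: "\<phi> \<in> test_functions \<Omega> \<Longrightarrow> continuous_on UNIV \<phi>"
  using test_Ck[of \<phi> \<Omega> 0] by simp

text \<open>Partial derivatives are test functions again, so continuity and boundedness of
  \<open>grad\<close>, and with them its square-integrability, follow from the scalar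
  results.\<close>

lemma test_grad_component:
  assumes "\<phi> \<in> test_functions \<Omega>"
  shows "(\<lambda>x. grad \<phi> x $ i) \<in> test_functions \<Omega>"
proof -
  obtain K where "compact K" "K \<subseteq> \<Omega>" "\<And>x. x \<notin> K \<Longrightarrow> grad \<phi> x = 0"
    using test_functionsE[OF assms] by metis
  then show ?thesis
    using Ck_grad[OF test_Ck[OF assms]] by (intro test_functionsI[of _ K]) auto
qed

lemma test_mult:
  assumes "\<phi> \<in> test_functions \<Omega>" and "\<psi> \<in> test_functions \<Omega>"
  shows "(\<lambda>x. \<phi> x * \<psi> x) \<in> test_functions \<Omega>"
proof -
  obtain K where "compact K" "K \<subseteq> \<Omega>" "\<And>x. x \<notin> K \<Longrightarrow> \<phi> x = 0"
    using test_functionsE[OF assms(1)] by metis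
  then show ?thesis
    using Ck_mult[OF test_Ck[OF assms(1)] test_Ck[OF assms(2)]]
    by (intro test_functionsI[of _ K]) auto
qed

lemma test_lincomb:
  assumes "\<phi> \<in> test_functions \<Omega>" and "\<psi> \<in> test_functions \<Omega>"
  shows "(\<lambda>x. \<phi> x + c * \<psi> x) \<in> test_functions \<Omega>"
proof -
  obtain K where "compact K" "K \<subseteq> \<Omega>" "\<And>x. x \<notin> K \<Longrightarrow> \<phi> x = 0"
    using test_functionsE[OF assms(1)] by metis
  moreover obtain L where "compact L" "L \<subseteq> \<Omega>" "\<And>x. x \<notin> L \<Longrightarrow> \<psi> x = 0"
    using test_functionsE[OF assms(2)] by metis
  ultimately show ?thesis
    using Ck_add[OF test_Ck[OF assms(1)] Ck_mult[OF Ck_const test_Ck[OF assms(2)]]]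
    by (intro test_functionsI[of _ "K \<union> L"]) auto
qed

lemma grad_lincomb:
  assumes "\<phi> \<in> test_functions \<Omega>" and "\<psi> \<in> test_functions \<Omega>"
  shows "grad (\<lambda>x. \<phi> x + c * \<psi> x) x = grad \<phi> x + c *\<^sub>R grad \<psi> x"
proof (rule grad_eq)
  have "GDERIV (\<lambda>x. c * \<psi> x) x :> c *\<^sub>R grad \<psi> x + \<psi> x *\<^sub>R 0"
    by (intro GDERIV_mult GDERIV_const test_GDERIV[OF assms(2)])
  then show "GDERIV (\<lambda>x. \<phi> x + c * \<psi> x) x :> grad \<phi> x + c *\<^sub>R grad \<psi> x"
    using GDERIV_add[OF test_GDERIV[OF assms(1)]] by simp
qed

lemma grad_mult_test:
  assumes "\<phi> \<in> test_functions \<Omega>" and "\<psi> \<in> test_functions \<Omega>"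
  shows "grad (\<lambda>x. \<phi> x * \<psi> x) x = \<phi> x *\<^sub>R grad \<psi> x + \<psi> x *\<^sub>R grad \<phi> x"
  by (intro grad_eq GDERIV_mult test_GDERIV[OF assms(1)] test_GDERIV[OF assms(2)])

lemma test_bounded:
  assumes "\<phi> \<in> test_functions \<Omega>"
  obtains B where "B > 0" and "\<And>x. \<bar>\<phi> x\<bar> \<le> B"
proof -
  obtain K where K: "compact K" "\<And>x. x \<notin> K \<Longrightarrow> \<phi> x = 0"
    using test_functionsE[OF assms] by metis
  have "bounded (\<phi> ` K)"
    using K(1) test_continuous[OF assms] continuous_on_subset
    by (blast intro: compact_imp_bounded compact_continuous_image)
  then obtain B where "B > 0" "\<And>y. y \<in> \<phi> ` K \<Longrightarrow> \<bar>y\<bar> \<le> B"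
    by (auto simp: bounded_pos)
  moreover have "\<bar>\<phi> x\<bar> \<le> B" for x
    using calculation K(2)[of x] by (cases "x \<in> K") auto
  ultimately show ?thesis using that by blast
qed

lemma test_grad_bounded:
  assumes "\<phi> \<in> test_functions \<Omega>"
  obtains B where "B > 0" and "\<And>x. norm (grad \<phi> x) \<le> B"
proof -
  have "\<forall>i. \<exists>B>0. \<forall>x. \<bar>grad \<phi> x $ i\<bar> \<le> B"
    using test_bounded[OF test_grad_component[OF assms]] by metis
  then obtain B where B: "\<And>i. B i > 0" "\<And>i x. \<bar>grad \<phi> x $ i\<bar> \<le> B i" by metis
  have "norm (grad \<phi> x) \<le> (\<Sum>i\<in>UNIV. B i)" for x
    by (rule order_trans[OF norm_le_l1_cart sum_mono[OF B(2)]])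
  then show ?thesis by (intro that[of "\<Sum>i\<in>UNIV. B i"]) (auto intro!: sum_pos B)
qed

lemma test_borel: "\<phi> \<in> test_functions \<Omega> \<Longrightarrow> \<phi> \<in> borel_measurable borel"
  by (intro borel_measurable_continuous_onI test_continuous)

lemma test_grad_borel:
  assumes "\<phi> \<in> test_functions \<Omega>"
  shows "grad \<phi> \<in> borel_measurable borel"
proof (rule borel_measurable_continuous_onI)
  have "continuous_on UNIV (\<lambda>x. \<chi> i. grad \<phi> x $ i)"
    by (intro continuous_on_vec_lambda test_continuous[OF test_grad_component[OF assms]])
  then show "continuous_on UNIV (grad \<phi>)" by simp
qed

lemma borel_measurable_lebesgue_on:
  "f \<in> borel_measurable borel \<Longrightarrow> f \<in> borel_measurable (lebesgue_on S)"
  by (intro measurable_restrict_space1 measurable_completion) simp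

lemma test_L2:
  assumes "\<Omega> \<in> lmeasurable" and "\<phi> \<in> test_functions \<Omega>"
  shows "\<phi> \<in> L2 \<Omega>"
proof -
  obtain B where "\<And>x. \<bar>\<phi> x\<bar> \<le> B" using test_bounded[OF assms(2)] by blast
  then show ?thesis
    by (intro L2_of_bounded[OF assms(1), where B=B] borel_measurable_lebesgue_on test_borel[OF assms(2)])
      auto
qed

lemma test_grad_L2:
  assumes "\<Omega> \<in> lmeasurable" and "\<phi> \<in> test_functions \<Omega>"
  shows "grad \<phi> \<in> L2 \<Omega>"
proof -
  obtain B where "\<And>x. norm (grad \<phi> x) \<le> B" using test_grad_bounded[OF assms(2)] by blast
  then show ?thesis
    by (intro L2_of_bounded[OF assms(1), where B=B] borel_measurable_lebesgue_on
        test_grad_borel[OF assms(2)])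
qed

subsection \<open>Integration by parts for test functions\<close>

text \<open>The directional derivative as a limit along the steps 1/(n+1), in the sequential form
  that dominated convergence asks for.\<close>

lemma GDERIV_LIMSEQ:
  assumes "GDERIV f x :> D"
  shows "(\<lambda>n. (f (x + inverse (real (Suc n)) *\<^sub>R e) - f x) / inverse (real (Suc n))) \<longlonglongrightarrow> e \<bullet> D"
proof -
  have "((\<lambda>t. x + t *\<^sub>R e) has_derivative (\<lambda>t. t *\<^sub>R e)) (at 0)"
    by (auto intro!: derivative_eq_intros)
  from has_derivative_compose[OF this, of f "\<lambda>h. h \<bullet> D"] assms
  have "((\<lambda>t. f (x + t *\<^sub>R e)) has_derivative (\<lambda>t. (t *\<^sub>R e) \<bullet> D)) (at 0)"
    by (simp add: gderiv_def)
  then have "((\<lambda>t. f (x + t *\<^sub>R e)) has_field_derivative e \<bullet> D) (at 0)"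
    by (simp add: has_field_derivative_def mult_commute_abs)
  then have "((\<lambda>t. (f (x + t *\<^sub>R e) - f x) / t) \<longlongrightarrow> e \<bullet> D) (at 0)"
    by (simp add: DERIV_def)
  moreover have "filterlim (\<lambda>n. inverse (real (Suc n))) (at 0) sequentially"
    using LIMSEQ_inverse_real_of_nat by (auto simp: filterlim_at)
  ultimately show ?thesis by (rule filterlim_compose)
qed

text \<open>Moves the integral to \<open>lborel\<close>, where translation invariance is
  available.\<close>

lemma integral_lebesgue_on_supported:
  fixes f :: "real^'d \<Rightarrow> real"
  assumes "S \<in> sets lebesgue" and "f \<in> borel_measurable borel" and "\<And>x. x \<notin> S \<Longrightarrow> f x = 0"
  shows "(LINT x|lebesgue_on S. f x) = (LINT x|lborel. f x)"
proof -
  have "(LINT x|lebesgue_on S. f x) = (LINT x|lebesgue. indicator S x *\<^sub>R f x)"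
    using assms(1) by (intro integral_restrict_space) auto
  also have "(\<lambda>x. indicator S x *\<^sub>R f x) = f"
    using assms(3) by (auto simp: indicator_def fun_eq_iff)
  finally show ?thesis using assms(2) by (simp add: integral_completion)
qed

text \<open>The difference quotients of \<open>\<phi>\<close> integrate to zero by translation invariance.\<close>

lemma integral_grad_test:
  fixes \<phi> :: "real^'d \<Rightarrow> real"
  assumes "\<Omega> \<in> sets lebesgue" and "\<phi> \<in> test_functions \<Omega>"
  shows "(LINT x|lebesgue_on \<Omega>. grad \<phi> x $ i) = 0"
proof -
  define h where "h n = inverse (real (Suc n)) *\<^sub>R (axis i 1 :: real^'d)" for n
  define D where "D n x = (\<phi> (x + h n) - \<phi> x) / inverse (real (Suc n))" for n x
  obtain K where K: "compact K" "K \<subseteq> \<Omega>" "\<And>x. x \<notin> K \<Longrightarrow> \<phi> x = 0" "\<And>x. x \<notin> K \<Longrightarrow> grad \<phi> x = 0"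
    using test_functionsE[OF assms(2)] by metis
  obtain R where R: "\<And>x. x \<in> K \<Longrightarrow> norm x \<le> R"
    using compact_imp_bounded[OF K(1)] by (auto simp: bounded_iff)
  obtain B where B: "B > 0" "\<And>x. norm (grad \<phi> x) \<le> B" using test_grad_bounded[OF assms(2)] by blast
  obtain B' where B': "B' > 0" "\<And>x. \<bar>\<phi> x\<bar> \<le> B'" using test_bounded[OF assms(2)] by blast
  note [measurable] = test_borel[OF assms(2)] test_grad_borel[OF assms(2)]
  have norm_h: "norm (h n) = inverse (real (Suc n))" for n by (simp add: h_def)
  then have norm_h1: "norm (h n) \<le> 1" for n by (simp add: inverse_le_1_iff)
  \<comment> \<open>A Lipschitz bound for \<phi> bounds all difference quotients at once.\<close>
  have lip: "\<bar>\<phi> y - \<phi> x\<bar> \<le> B * norm (y - x)" for x y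
  proof -
    have "norm (\<phi> y - \<phi> x) \<le> B * norm (y - x)"
    proof (rule differentiable_bound[of UNIV \<phi> "\<lambda>x h. h \<bullet> grad \<phi> x"])
      show "(\<phi> has_derivative (\<lambda>h. h \<bullet> grad \<phi> z)) (at z within UNIV)" for z
        using test_GDERIV[OF assms(2)] by (simp add: gderiv_def)
      show "onorm (\<lambda>h. h \<bullet> grad \<phi> z) \<le> B" for z
      proof (rule onorm_le)
        fix h :: "real^'d"
        have "norm (h \<bullet> grad \<phi> z) \<le> norm h * norm (grad \<phi> z)"
          using Cauchy_Schwarz_ineq2 by simp
        also have "\<dots> \<le> norm h * B" using B(2) by (intro mult_left_mono) auto
        finally show "norm (h \<bullet> grad \<phi> z) \<le> B * norm h" by (simp add: mult.commute)
      qed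
    qed auto
    then show ?thesis by simp
  qed
  \<comment> \<open>The shifts have length at most 1, so the ball of radius \<open>R + 1\<close>
    contains the supports of all difference quotients.\<close>
  have dom: "norm (D n x) \<le> B * indicator (cball 0 (R + 1)) x" for n x
  proof (cases "x \<in> cball 0 (R + 1)")
    case True
    have "norm (a / t) \<le> B" if "t > 0" "\<bar>a\<bar> \<le> B * t" for a t :: real
      using that by (simp add: pos_divide_le_eq)
    then have "norm (D n x) \<le> B"
      unfolding D_def using lip[of "x + h n" x] by (simp add: norm_h)
    then show ?thesis using True by simp
  next
    case False
    then have "norm x > R + 1" by simp
    moreover have "norm (x + h n) \<ge> norm x - 1"
      using norm_h1[of n] norm_triangle_ineq4[of "x + h n" "h n"] by simp
    ultimately have "x \<notin> K" "x + h n \<notin> K" using R[of x] R[of "x + h n"] by auto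
    then show ?thesis using K B(1) by (simp add: D_def)
  qed
  have int: "integrable lborel \<phi>"
  proof (rule Bochner_Integration.integrable_bound)
    show "integrable lborel (\<lambda>x. B' * indicator (cball 0 R) x :: real)"
      by (intro integrable_mult_right integrable_real_indicator emeasure_lborel_cball_finite) simp
    show "AE x in lborel. norm (\<phi> x) \<le> norm (B' * indicator (cball 0 R) x :: real)"
    proof (intro AE_I2)
      fix x show "norm (\<phi> x) \<le> norm (B' * indicator (cball 0 R) x :: real)"
        using B' K(3)[of x] R[of x] by (cases "x \<in> K") (auto simp: indicator_def)
    qed
  qed simp
  have zero: "(LINT x|lborel. D n x) = 0" for n
  proof -
    have "(LINT x|lborel. \<phi> (x + h n)) = (LINT x|distr lborel borel ((+) (h n)). \<phi> x)"
      by (subst integral_distr) (auto simp: add.commute)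
    also have "\<dots> = (LINT x|lborel. \<phi> x)" by (simp add: lborel_distr_plus)
    finally have "(LINT x|lborel. \<phi> (x + h n)) = (LINT x|lborel. \<phi> x)" .
    moreover have "integrable lborel (\<lambda>x. \<phi> (x + h n))"
    proof -
      have "integrable (distr lborel borel ((+) (h n))) \<phi>"
        using int by (simp add: lborel_distr_plus)
      then show ?thesis by (subst (asm) integrable_distr_eq) (auto simp: add.commute)
    qed
    ultimately show ?thesis using int by (simp add: D_def)
  qed
  have "(\<lambda>n. LINT x|lborel. D n x) \<longlonglongrightarrow> (LINT x|lborel. grad \<phi> x $ i)"
  proof (rule integral_dominated_convergence)
    show "(\<lambda>x. grad \<phi> x $ i) \<in> borel_measurable lborel"
      using test_borel[OF test_grad_component[OF assms(2)]] by simp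
    show "D n \<in> borel_measurable lborel" for n unfolding D_def by measurable
    show "integrable lborel (\<lambda>x. B * indicator (cball 0 (R + 1)) x :: real)"
      by (intro integrable_mult_right integrable_real_indicator emeasure_lborel_cball_finite) simp
    show "AE x in lborel. (\<lambda>n. D n x) \<longlonglongrightarrow> grad \<phi> x $ i"
      using GDERIV_LIMSEQ[OF test_GDERIV[OF assms(2)], where e = "axis i 1"]
      by (intro AE_I2) (simp add: D_def h_def inner_axis')
  qed (use dom in auto)
  then have "(LINT x|lborel. grad \<phi> x $ i) = 0" by (simp add: zero LIMSEQ_const_iff)
  moreover have "grad \<phi> x $ i = 0" if "x \<notin> \<Omega>" for x
    using that K(2) K(4)[of x] by (metis subsetD zero_index)
  then have "(LINT x|lebesgue_on \<Omega>. grad \<phi> x $ i) = (LINT x|lborel. grad \<phi> x $ i)"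
    using assms(1) test_borel[OF test_grad_component[OF assms(2)]]
    by (intro integral_lebesgue_on_supported)
  ultimately show ?thesis by simp
qed

lemma L2inner_real: "L2inner \<Omega> f g = (LINT x|lebesgue_on \<Omega>. f x * g x)"
  for f g :: "real^'d \<Rightarrow> real"
  by (simp add: L2inner_def)

lemma integral_vec_component:
  fixes f :: "_ \<Rightarrow> real^'n"
  assumes "integrable M f"
  shows "(LINT x|M. f x) $ i = (LINT x|M. f x $ i)"
  using integral_bounded_linear[OF bounded_linear_vec_nth assms] by simp

lemma L2_mult_test_integrable:
  assumes "\<phi> \<in> test_functions \<Omega>" and "\<Omega> \<in> lmeasurable" and "g \<in> L2 \<Omega>"
  shows "integrable (lebesgue_on \<Omega>) (\<lambda>x. \<phi> x *\<^sub>R g x)"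
proof (rule Bochner_Integration.integrable_bound)
  have "(\<lambda>x. norm (g x)) \<in> L2 \<Omega>" using assms(3) by (auto simp: L2_def)
  then show "integrable (lebesgue_on \<Omega>) (\<lambda>x. \<phi> x * norm (g x))"
    using L2_inner_integrable[OF test_L2[OF assms(2,1)]] by simp
  show "(\<lambda>x. \<phi> x *\<^sub>R g x) \<in> borel_measurable (lebesgue_on \<Omega>)"
    using L2_measurable[OF assms(3)] L2_measurable[OF test_L2[OF assms(2,1)]] by measurable
qed (auto simp: abs_mult)

text \<open>The defining identity compares vector-valued integrals. Read by coordinates it becomes
  scalar, and thus accessible to \<open>L2inner\<close> and to the fundamental lemma; integrability
  of both vector fields is what lets the coordinate pass under the integral.\<close>

lemma has_weak_grad_iff:
  assumes "\<Omega> \<in> lmeasurable" and "w \<in> L2 \<Omega>" and "g \<in> L2 \<Omega>"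
  shows "has_weak_grad \<Omega> w g \<longleftrightarrow> (\<forall>\<phi> \<in> test_functions \<Omega>. \<forall>i.
    L2inner \<Omega> w (\<lambda>x. grad \<phi> x $ i) = - L2inner \<Omega> (\<lambda>x. g x $ i) \<phi>)"
proof -
  have "(LINT x|lebesgue_on \<Omega>. w x *\<^sub>R grad \<phi> x) = - (LINT x|lebesgue_on \<Omega>. \<phi> x *\<^sub>R g x) \<longleftrightarrow>
    (\<forall>i. L2inner \<Omega> w (\<lambda>x. grad \<phi> x $ i) = - L2inner \<Omega> (\<lambda>x. g x $ i) \<phi>)"
    if \<phi>: "\<phi> \<in> test_functions \<Omega>" for \<phi>
  proof -
    have 1: "integrable (lebesgue_on \<Omega>) (\<lambda>x. \<phi> x *\<^sub>R g x)"
      using assms \<phi> L2_mult_test_integrable by blast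
    have 2: "integrable (lebesgue_on \<Omega>) (\<lambda>x. w x *\<^sub>R grad \<phi> x)"
    proof (rule Bochner_Integration.integrable_bound)
      have "(\<lambda>x. norm (grad \<phi> x)) \<in> L2 \<Omega>" using test_grad_L2[OF assms(1) \<phi>] by (auto simp: L2_def)
      then show "integrable (lebesgue_on \<Omega>) (\<lambda>x. w x * norm (grad \<phi> x))"
        using L2_inner_integrable[OF assms(2)] by simp
      show "(\<lambda>x. w x *\<^sub>R grad \<phi> x) \<in> borel_measurable (lebesgue_on \<Omega>)"
        using L2_measurable[OF assms(2)] L2_measurable[OF test_grad_L2[OF assms(1) \<phi>]] by measurable
    qed (auto simp: abs_mult)
    show ?thesis
      by (simp add: vec_eq_iff integral_vec_component[OF 1] integral_vec_component[OF 2]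
          L2inner_real mult.commute)
  qed
  then show ?thesis using assms by (auto simp: has_weak_grad_def)
qed

lemma has_weak_div_iff:
  "has_weak_div \<Omega> \<tau> g \<longleftrightarrow> g \<in> L2 \<Omega> \<and>
    (\<forall>\<phi> \<in> test_functions \<Omega>. L2inner \<Omega> \<tau> (grad \<phi>) = - L2inner \<Omega> g \<phi>)"
  by (simp add: has_weak_div_def L2inner_def)

text \<open>The product of two test functions is a test function, so its gradient integrates to
  zero; the product rule turns this into integration by parts.\<close>

lemma has_weak_grad_test:
  assumes "\<Omega> \<in> lmeasurable" and \<phi>: "\<phi> \<in> test_functions \<Omega>"
  shows "has_weak_grad \<Omega> \<phi> (grad \<phi>)"
proof -
  have "L2inner \<Omega> \<phi> (\<lambda>x. grad \<psi> x $ i) = - L2inner \<Omega> (\<lambda>x. grad \<phi> x $ i) \<psi>"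
    if \<psi>: "\<psi> \<in> test_functions \<Omega>" for \<psi> i
  proof -
    have [simp]: "integrable (lebesgue_on \<Omega>) (\<lambda>x. \<phi> x * grad \<psi> x $ i)"
      "integrable (lebesgue_on \<Omega>) (\<lambda>x. \<psi> x * grad \<phi> x $ i)"
      using L2_inner_integrable[OF test_L2[OF assms(1)] test_L2[OF assms(1) test_grad_component]] \<phi> \<psi>
      by auto
    have "(LINT x|lebesgue_on \<Omega>. grad (\<lambda>x. \<phi> x * \<psi> x) x $ i) = 0"
      using assms by (intro integral_grad_test test_mult \<phi> \<psi>) auto
    then have "(LINT x|lebesgue_on \<Omega>. \<phi> x * grad \<psi> x $ i + \<psi> x * grad \<phi> x $ i) = 0"
      by (simp add: grad_mult_test[OF \<phi> \<psi>])
    then show ?thesis by (simp add: L2inner_real mult.commute[of "grad _ _ $ _"])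
  qed
  then show ?thesis
    using has_weak_grad_iff[OF assms(1) test_L2[OF assms] test_grad_L2[OF assms]] by blast
qed

section \<open>The fundamental lemma of the calculus of variations\<close>

text \<open>For q = 1 this is the classical smooth function exp(-1/t), extended by 0. The polynomial
  parameter makes the family closed under differentiation, so that smoothness is a single
  induction.\<close>

definition bump :: "real poly \<Rightarrow> real \<Rightarrow> real" where
  "bump q t = (if t > 0 then poly q (1 / t) * exp (- (1 / t)) else 0)"

text \<open>With s = 1/t this says that every member of the family is flat at 0 from the
  right.\<close>

lemma poly_times_exp_tendsto_0: "((\<lambda>s. poly q s * exp (- s)) \<longlongrightarrow> (0::real)) at_top"
proof -
  have "((\<lambda>s. \<Sum>i\<le>degree q. coeff q i * (s ^ i / exp s)) \<longlongrightarrow> (\<Sum>i\<le>degree q. coeff q i * 0)) at_top"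
    by (intro tendsto_sum tendsto_mult tendsto_const tendsto_power_div_exp_0)
  then show ?thesis
    by (simp add: poly_altdef sum_distrib_right exp_minus divide_inverse mult.assoc)
qed

text \<open>With \<open>s = 1/t\<close> the derivative of \<open>q(s) exp(-s)\<close> in \<open>t\<close> is \<open>s\<^sup>2 (q(s) - q'(s)) exp(-s)\<close>.\<close>

lemma DERIV_bump: "DERIV (bump q) t :> bump ([:0, 0, 1:] * (q - pderiv q)) t"
proof -
  consider "t > 0" | "t < 0" | "t = 0" by linarith
  then show ?thesis
  proof cases
    case 1
    then have "((\<lambda>t. poly q (1 / t) * exp (- (1 / t))) has_field_derivative
        bump ([:0, 0, 1:] * (q - pderiv q)) t) (at t)"
      by (auto intro!: derivative_eq_intros DERIV_chain2[OF poly_DERIV]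
          simp: bump_def field_simps power2_eq_square)
    then show ?thesis
      by (rule has_field_derivative_transform_within_open[where S = "{0<..}"])
        (use 1 in \<open>auto simp: bump_def\<close>)
  next
    case 2
    have "((\<lambda>t. 0) has_field_derivative 0) (at t)" by simp
    then have "(bump q has_field_derivative 0) (at t)"
      by (rule has_field_derivative_transform_within_open[where S = "{..<0}"])
        (use 2 in \<open>auto simp: bump_def\<close>)
    then show ?thesis using 2 by (simp add: bump_def)
  next
    case 3
    \<comment> \<open>At 0 the difference quotient is \<open>bump q h / h\<close>. Dividing by h
      multiplies by s = 1/h, and \<open>pCons 0 q\<close> is the polynomial s q(s).\<close>
    have "((\<lambda>h. poly (pCons 0 q) (inverse h) * exp (- inverse h)) \<longlongrightarrow> 0) (at_right 0)"
      by (rule filterlim_compose[OF poly_times_exp_tendsto_0 filterlim_inverse_at_top_right])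
    moreover have "\<forall>\<^sub>F h in at_right 0. poly (pCons 0 q) (inverse h) * exp (- inverse h) = bump q h / h"
      by (auto simp: eventually_at_filter bump_def divide_inverse)
    ultimately have "((\<lambda>h. bump q h / h) \<longlongrightarrow> 0) (at_right 0)"
      by (rule Lim_transform_eventually)
    moreover have "((\<lambda>h. bump q h / h) \<longlongrightarrow> 0) (at_left 0)"
      by (rule tendsto_eventually) (auto simp: eventually_at_filter bump_def)
    ultimately have "((\<lambda>h. bump q h / h) \<longlongrightarrow> 0) (at 0)"
      by (simp add: filterlim_split_at)
    then show ?thesis using 3 by (simp add: DERIV_def bump_def)
  qed
qed

text \<open>The induction ranges over all \<open>q\<close> since each derivative has a new
  polynomial. Affine arguments with positive and negative \<open>c\<close> provide the cut-offs at
  the two opposite faces of a box.\<close>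

lemma Ck_bump: "Ck k (\<lambda>x::real^'d. bump q (c * x $ i + d))"
proof (induction k arbitrary: q)
  have "GDERIV (\<lambda>x::real^'d. c * x $ i + d) x :> c *\<^sub>R axis i 1" for x
    unfolding gderiv_def
    by (auto intro!: derivative_eq_intros bounded_linear.has_derivative[OF bounded_linear_vec_nth]
        simp: inner_axis)
  note chain = GDERIV_DERIV_compose[OF this DERIV_bump]
  {
    case 0
    have "isCont (\<lambda>x::real^'d. bump q (c * x $ i + d)) x" for x
      using chain[of q x] unfolding gderiv_def by (rule has_derivative_continuous)
    then show ?case by (simp add: continuous_at_imp_continuous_on)
  next
    case (Suc k)
    show ?case unfolding Ck.simps(2)
    proof (intro exI conjI allI)
      show "GDERIV (\<lambda>x::real^'d. bump q (c * x $ i + d)) x :>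
          bump ([:0, 0, 1:] * (q - pderiv q)) (c * x $ i + d) *\<^sub>R (c *\<^sub>R axis i 1)" for x
        by (rule chain)
      show "Ck k (\<lambda>x::real^'d. (bump ([:0, 0, 1:] * (q - pderiv q)) (c * x $ i + d)
          *\<^sub>R (c *\<^sub>R axis i 1 :: real^'d)) $ j)" for j
        using Ck_mult[OF Suc.IH Ck_const] by (simp add: mult.assoc)
    qed
  }
qed

section \<open>Smooth approximation of indicators of boxes\<close>

lemma bump_1_bounds: "0 \<le> bump 1 t" "bump 1 t \<le> 1"
  by (auto simp: bump_def)

lemma bump_1_tendsto:
  assumes "t > 0"
  shows "(\<lambda>n. bump 1 (real (Suc n) * t)) \<longlonglongrightarrow> 1"
proof -
  have "(\<lambda>n. exp (- (inverse (real (Suc n)) * inverse t))) \<longlonglongrightarrow> exp (- (0 * inverse t))"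
    by (intro tendsto_intros LIMSEQ_inverse_real_of_nat)
  then show ?thesis using assms by (simp add: bump_def divide_inverse)
qed

text \<open>In each coordinate, multiply exp(-1/(n (x_i - a_i))) by exp(-1/(n (b_i - x_i))), both
  extended by 0. The product over all coordinates vanishes off the open box, and inside it every
  exponent tends to 0 as n grows.\<close>

lemma test_functions_approx_box:
  fixes a b :: "real^'d"
  assumes "cbox a b \<subseteq> \<Omega>"
  obtains \<psi> where "\<And>n. \<psi> n \<in> test_functions \<Omega>" and "\<And>n x. \<bar>\<psi> n x\<bar> \<le> 1"
    and "\<And>x. (\<lambda>n. \<psi> n x) \<longlonglongrightarrow> indicator (box a b) x"
proof
  \<comment> \<open>Expanded to the affine form that \<open>Ck_bump\<close> matches;
    \<open>s_alt\<close> is the factored form that shows the sign.\<close>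
  define s where "s = (\<lambda>n i (x::real^'d). bump 1 (real (Suc n) * x $ i + - real (Suc n) * a $ i)
    * bump 1 (- real (Suc n) * x $ i + real (Suc n) * b $ i))"
  define \<psi> where "\<psi> n x = (\<Prod>i\<in>UNIV. s n i x)" for n x
  have s_alt: "s n i x = bump 1 (real (Suc n) * (x $ i - a $ i)) * bump 1 (real (Suc n) * (b $ i - x $ i))"
    for n i x by (simp add: s_def algebra_simps)
  have s_bounds: "0 \<le> s n i x" "s n i x \<le> 1" for n i x
    unfolding s_def by (auto intro!: mult_nonneg_nonneg mult_le_one bump_1_bounds)
  have zero: "\<psi> n x = 0" if x: "x \<notin> box a b" for n x
  proof -
    obtain i where "x $ i \<le> a $ i \<or> b $ i \<le> x $ i"
      using x by (auto simp: mem_box_cart not_less)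
    then have "s n i x = 0"
      by (auto simp: s_alt bump_def zero_less_mult_iff)
    then show ?thesis unfolding \<psi>_def by (auto intro: prod_zero)
  qed
  show "\<psi> n \<in> test_functions \<Omega>" for n
  proof (rule test_functionsI[of _ "cbox a b"])
    show "Ck k (\<psi> n)" for k
      unfolding \<psi>_def s_def by (intro Ck_prod Ck_mult Ck_bump)
    show "\<psi> n x = 0" if "x \<notin> cbox a b" for x
      using zero box_subset_cbox that by blast
  qed (use assms in auto)
  show "\<bar>\<psi> n x\<bar> \<le> 1" for n x
    using s_bounds by (auto simp: \<psi>_def prod_nonneg intro!: prod_le_1)
  show "(\<lambda>n. \<psi> n x) \<longlonglongrightarrow> indicator (box a b) x" for x
  proof (cases "x \<in> box a b")
    case True
    have "(\<lambda>n. \<Prod>i\<in>UNIV. s n i x) \<longlonglongrightarrow> (\<Prod>i\<in>(UNIV::'d set). 1 * 1)"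
      unfolding s_alt
      by (intro tendsto_prod tendsto_mult bump_1_tendsto) (use True in \<open>auto simp: mem_box_cart\<close>)
    then show ?thesis using True by (simp add: \<psi>_def)
  qed (simp add: zero)
qed

section \<open>From test functions to boxes, Borel sets and null sets\<close>

lemma L2_integrable:
  fixes g :: "real^'d \<Rightarrow> real"
  assumes "\<Omega> \<in> lmeasurable" and "g \<in> L2 \<Omega>"
  shows "integrable (lebesgue_on \<Omega>) g"
  using L2_inner_integrable[OF assms(2) L2_of_bounded[OF assms(1), of "\<lambda>x. 1" 1]] by simp

text \<open>Dominated convergence under \<open>\<bar>g\<bar>\<close>, which is integrable because
  \<Omega> has finite measure.\<close>

lemma integral_box_eq_0:
  fixes g :: "real^'d \<Rightarrow> real"
  assumes "\<Omega> \<in> lmeasurable" and "g \<in> L2 \<Omega>"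
    and "\<And>\<phi>. \<phi> \<in> test_functions \<Omega> \<Longrightarrow> L2inner \<Omega> g \<phi> = 0"
    and "cbox a b \<subseteq> \<Omega>"
  shows "(LINT x|lebesgue_on \<Omega>. g x * indicator (box a b) x) = 0"
proof -
  obtain \<psi> where \<psi>: "\<And>n. \<psi> n \<in> test_functions \<Omega>" "\<And>n x. \<bar>\<psi> n x\<bar> \<le> 1"
    "\<And>x. (\<lambda>n. \<psi> n x) \<longlonglongrightarrow> indicator (box a b) x"
    using test_functions_approx_box[OF assms(4)] by blast
  have [measurable]: "g \<in> borel_measurable (lebesgue_on \<Omega>)" using assms(2) by (rule L2_measurable)
  have [measurable]: "\<psi> n \<in> borel_measurable (lebesgue_on \<Omega>)" for n
    using test_borel[OF \<psi>(1)] by (rule borel_measurable_lebesgue_on)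
  have [measurable]: "(indicator (box a b) :: _ \<Rightarrow> real) \<in> borel_measurable (lebesgue_on \<Omega>)"
    by (rule borel_measurable_lebesgue_on) measurable
  have "(\<lambda>n. LINT x|lebesgue_on \<Omega>. g x * \<psi> n x)
      \<longlonglongrightarrow> (LINT x|lebesgue_on \<Omega>. g x * indicator (box a b) x)"
  proof (rule integral_dominated_convergence)
    show "integrable (lebesgue_on \<Omega>) (\<lambda>x. \<bar>g x\<bar>)"
      using L2_integrable[OF assms(1,2)] by simp
    show "AE x in lebesgue_on \<Omega>. (\<lambda>n. g x * \<psi> n x) \<longlonglongrightarrow> g x * indicator (box a b) x"
      by (intro AE_I2 tendsto_mult tendsto_const \<psi>(3))
    show "AE x in lebesgue_on \<Omega>. norm (g x * \<psi> n x) \<le> \<bar>g x\<bar>" for n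
      using \<psi>(2) by (intro AE_I2) (simp add: abs_mult mult_left_le)
  qed measurable
  moreover have "(LINT x|lebesgue_on \<Omega>. g x * \<psi> n x) = 0" for n
    using assms(3)[OF \<psi>(1)] by (simp add: L2inner_real)
  ultimately show ?thesis by (simp add: LIMSEQ_const_iff)
qed

text \<open>Dynkin's argument: open boxes are stable under intersection and generate the Borel sets,
  while the sets over which g integrates to 0 are closed under disjoint countable unions and, since
  the integral over the whole space is 0, under complements.\<close>

lemma integral_borel_eq_0_of_boxes:
  fixes g :: "real^'d \<Rightarrow> real"
  assumes "integrable lebesgue g" and "\<And>c d. (LINT x|lebesgue. g x * indicator (box c d) x) = 0"
    and "(LINT x|lebesgue. g x) = 0"
    and "A \<in> sets borel"
  shows "(LINT x|lebesgue. g x * indicator A x) = 0"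
proof -
  have int: "integrable lebesgue (\<lambda>x. g x * indicator B x)" if "B \<in> sets borel" for B
    using integrable_mult_indicator[OF _ assms(1), of B] that by (simp add: mult.commute)
  have "Int_stable (range (\<lambda>(c::real^'d, d). box c d))"
  proof (rule Int_stableI)
    have "box c d \<in> range (\<lambda>(c::real^'d, d). box c d)" for c d
      by (rule range_eqI[of _ _ "(c, d)"]) simp
    then show "A \<inter> B \<in> range (\<lambda>(c::real^'d, d). box c d)"
      if "A \<in> range (\<lambda>(c, d). box c d)" "B \<in> range (\<lambda>(c, d). box c d)" for A B
      using that by (auto simp: box_Int_box)
  qed
  moreover have "range (\<lambda>(c::real^'d, d). box c d) \<subseteq> Pow UNIV" by simp
  moreover have "A \<in> sigma_sets UNIV (range (\<lambda>(c, d). box c d))"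
    using assms(4) unfolding borel_eq_box by (simp add: sets_measure_of)
  ultimately show ?thesis
  proof (induction rule: sigma_sets_induct_disjoint)
    case (basic A)
    then show ?case using assms(2) by auto
  next
    case empty
    show ?case by simp
  next
    case (compl A)
    then have "A \<in> sets borel" unfolding borel_eq_box by (simp add: sets_measure_of)
    moreover have "(\<lambda>x. g x * indicator (UNIV - A) x) = (\<lambda>x. g x - g x * indicator A x)"
      by (auto simp: indicator_def)
    ultimately show ?case using compl assms(1,3) int by simp
  next
    case (union A)
    then have A: "A i \<in> sets borel" for i
      unfolding borel_eq_box by (auto simp: sets_measure_of)
    have "(LINT x:(\<Union>i. A i)|lebesgue. g x) = (\<Sum>i. LINT x:A i|lebesgue. g x)"
    proof (rule lebesgue_integral_countable_add)
      show "set_integrable lebesgue (\<Union> (range A)) g"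
        using int[of "\<Union> (range A)"] A by (simp add: set_integrable_def mult.commute)
      show "A i \<inter> A j = {}" if "i \<noteq> j" for i j
        using union that by (auto simp: disjoint_family_on_def)
    qed (use A in auto)
    then show ?case using union by (simp add: set_lebesgue_integral_def mult.commute)
  qed
qed

text \<open>The test sets are those where the function is positive or negative. They have to be
  Borel, whereas \<open>g\<close> is only Lebesgue measurable; hence the passage to a Borel function
  that agrees with it almost everywhere.\<close>

lemma AE_eq_0_of_boxes:
  fixes g :: "real^'d \<Rightarrow> real"
  assumes "integrable lebesgue g" and "\<And>c d. (LINT x|lebesgue. g x * indicator (box c d) x) = 0"
    and "(LINT x|lebesgue. g x) = 0"
  shows "AE x in lebesgue. g x = 0"
proof -
  have "g \<in> borel_measurable (completion lborel)" using assms(1) by simp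
  then obtain g' where g': "g' \<in> borel_measurable lborel" "AE x in lborel. g x = g' x"
    using completion_ex_borel_measurable_real by blast
  have [measurable]: "g' \<in> borel_measurable borel" using g'(1) by simp
  have ae: "AE x in lebesgue. g x = g' x" using g'(2) by (rule AE_completion)
  have [measurable]: "g' \<in> borel_measurable lebesgue" using g'(1) by (intro measurable_completion)
  have [measurable]: "g \<in> borel_measurable lebesgue" using assms(1) by simp
  have int': "integrable lebesgue g'"
    using assms(1) ae by (subst integrable_cong_AE[of _ _ g]) auto
  have zero: "(LINT x|lebesgue. g' x * indicator A x) = 0" if "A \<in> sets borel" for A
  proof -
    have [measurable]: "A \<in> sets lebesgue" using that by simp
    have "(LINT x|lebesgue. g' x * indicator A x) = (LINT x|lebesgue. g x * indicator A x)"
      using ae by (intro integral_cong_AE) auto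
    then show ?thesis using integral_borel_eq_0_of_boxes[OF assms that] by simp
  qed
  have "(LINT x|lebesgue. \<bar>g' x\<bar>)
      = (LINT x|lebesgue. g' x * indicator {x. g' x > 0} x - g' x * indicator {x. g' x < 0} x)"
    by (intro Bochner_Integration.integral_cong) (auto simp: indicator_def)
  also have "\<dots> = (LINT x|lebesgue. g' x * indicator {x. g' x > 0} x)
      - (LINT x|lebesgue. g' x * indicator {x. g' x < 0} x)"
  proof (rule Bochner_Integration.integral_diff)
    have "integrable lebesgue (\<lambda>x. g' x * indicator A x)" if "A \<in> sets borel" for A
      using integrable_mult_indicator[OF _ int', of A] that by (simp add: mult.commute)
    then show "integrable lebesgue (\<lambda>x. g' x * indicator {x. g' x > 0} x)"
      "integrable lebesgue (\<lambda>x. g' x * indicator {x. g' x < 0} x)" by simp_all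
  qed
  also have "\<dots> = 0" by (simp add: zero)
  finally have "AE x in lebesgue. \<bar>g' x\<bar> = 0"
    using int' by (subst (asm) integral_nonneg_eq_0_iff_AE) auto
  with ae show ?thesis by eventually_elim simp
qed

text \<open>The problem is localised: on an open box whose closure lies in \<Omega>, g extended by 0
  integrates to 0 over every box. Countably many closed boxes exhaust \<Omega>, and their boundaries
  are null sets.\<close>

theorem fundamental_lemma:
  fixes g :: "real^'d \<Rightarrow> real"
  assumes "open \<Omega>" and "\<Omega> \<in> lmeasurable" and "g \<in> L2 \<Omega>"
    and "\<And>\<phi>. \<phi> \<in> test_functions \<Omega> \<Longrightarrow> L2inner \<Omega> g \<phi> = 0"
  shows "AE x in lebesgue_on \<Omega>. g x = 0"
proof -
  have box: "AE x in lebesgue. x \<in> box a b \<longrightarrow> g x = 0" if ab: "cbox a b \<subseteq> \<Omega>" for a b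
  proof -
    have sub: "box a b \<subseteq> \<Omega>" using ab box_subset_cbox by blast
    have to_lebesgue: "(LINT x|lebesgue. (indicator (box a b) x * g x) * indicator (box c d) x) = 0" for c d
    proof -
      \<comment> \<open>An arbitrary box cuts the given one in a box whose closure is again inside
        \<Omega>, so test functions can approximate its indicator.\<close>
      obtain p q where pq: "box a b \<inter> box c d = box p q" "cbox p q \<subseteq> \<Omega>"
        using box_Int_box[of a b c d] Int_interval[of a b c d] ab by blast
      have "(LINT x|lebesgue_on \<Omega>. g x * indicator (box p q) x)
          = (LINT x|lebesgue. indicator \<Omega> x *\<^sub>R (g x * indicator (box p q) x))"
        using assms(2) by (intro integral_restrict_space) auto
      also have "\<dots> = (LINT x|lebesgue. (indicator (box a b) x * g x) * indicator (box c d) x)"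
        using sub unfolding pq(1)[symmetric]
        by (intro Bochner_Integration.integral_cong) (auto simp: indicator_def)
      finally show ?thesis using integral_box_eq_0[OF assms(2-4) pq(2)] by simp
    qed
    have "integrable lebesgue (\<lambda>x. indicator \<Omega> x *\<^sub>R g x)"
      using L2_integrable[OF assms(2,3)] integrable_restrict_space[of \<Omega> lebesgue g] assms(2)
      by (simp add: fmeasurableD)
    then have "integrable lebesgue (\<lambda>x. indicator (box a b) x *\<^sub>R (indicator \<Omega> x *\<^sub>R g x))"
      by (rule integrable_mult_indicator[rotated]) auto
    moreover have "(\<lambda>x. indicator (box a b) x *\<^sub>R (indicator \<Omega> x *\<^sub>R g x)) = (\<lambda>x. indicator (box a b) x * g x)"
      using sub by (auto simp: indicator_def fun_eq_iff)
    ultimately have "integrable lebesgue (\<lambda>x. indicator (box a b) x * g x)" by simp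
    moreover have "(LINT x|lebesgue. indicator (box a b) x * g x) = 0"
    proof -
      have "(\<lambda>x. (indicator (box a b) x * g x) * indicator (box a b) x) = (\<lambda>x. indicator (box a b) x * g x)"
        by (auto simp: indicator_def)
      then show ?thesis using to_lebesgue[of a b] by simp
    qed
    ultimately have "AE x in lebesgue. indicator (box a b) x * g x = 0"
      by (intro AE_eq_0_of_boxes to_lebesgue)
    then show ?thesis by (rule AE_mp) (auto simp: indicator_def)
  qed
  obtain \<D> where \<D>: "countable \<D>" "\<D> \<subseteq> Pow \<Omega>" "\<And>X. X \<in> \<D> \<Longrightarrow> \<exists>a b. X = cbox a b" "\<Union>\<D> = \<Omega>"
    using open_countable_Union_open_cbox[OF assms(1)] by metis
  have "AE x in lebesgue. x \<in> X \<longrightarrow> g x = 0" if "X \<in> \<D>" for X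
  proof -
    obtain a b where X: "X = cbox a b" using \<D>(3)[OF \<open>X \<in> \<D>\<close>] by blast
    have "cbox a b - box a b \<in> null_sets lebesgue"
      using negligible_frontier_interval by (simp add: negligible_iff_null_sets)
    then have "AE x in lebesgue. x \<notin> cbox a b - box a b" by (rule AE_not_in)
    moreover have "AE x in lebesgue. x \<in> box a b \<longrightarrow> g x = 0"
      using \<D>(2) that X by (intro box) auto
    ultimately show ?thesis unfolding X by eventually_elim auto
  qed
  then have "AE x in lebesgue. \<forall>X\<in>\<D>. x \<in> X \<longrightarrow> g x = 0"
    by (intro AE_ball_countable[OF \<D>(1), THEN iffD2] ballI)
  then have "AE x in lebesgue. x \<in> \<Omega> \<longrightarrow> g x = 0"
    using \<D>(4) by (elim eventually_mono) blast
  then show ?thesis using assms(2) by (subst AE_restrict_space_iff) auto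
qed

section \<open>Sobolev spaces on a bounded open set\<close>

text \<open>Openness serves the fundamental lemma; boundedness gives the finite measure used for
  completeness and for square-integrability of test functions.\<close>

locale bounded_open_set =
  fixes \<Omega> :: "(real^'d) set"
  assumes open_\<Omega>: "open \<Omega>" and bounded_\<Omega>: "bounded \<Omega>"
begin

lemma lmeasurable_\<Omega>: "\<Omega> \<in> lmeasurable"
  using bounded_\<Omega> open_\<Omega> by (rule lmeasurable_open)

lemma has_weak_grad_unique:
  assumes "w \<in> L2 \<Omega>" and "has_weak_grad \<Omega> w g" and "has_weak_grad \<Omega> w g'"
  shows "AE x in lebesgue_on \<Omega>. g x = g' x"
proof -
  have g: "g \<in> L2 \<Omega>" "g' \<in> L2 \<Omega>" using assms by (auto simp: has_weak_grad_def)
  have "AE x in lebesgue_on \<Omega>. g x $ i - g' x $ i = 0" for i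
  proof (rule fundamental_lemma[OF open_\<Omega> lmeasurable_\<Omega>])
    show "(\<lambda>x. g x $ i - g' x $ i) \<in> L2 \<Omega>" by (intro L2_diff L2_component g)
    fix \<phi> assume \<phi>: "\<phi> \<in> test_functions \<Omega>"
    have "L2inner \<Omega> (\<lambda>x. g x $ i) \<phi> = L2inner \<Omega> (\<lambda>x. g' x $ i) \<phi>"
      using assms(2,3) \<phi> has_weak_grad_iff[OF lmeasurable_\<Omega> assms(1) g(1)]
        has_weak_grad_iff[OF lmeasurable_\<Omega> assms(1) g(2)]
      by (metis minus_equation_iff)
    then show "L2inner \<Omega> (\<lambda>x. g x $ i - g' x $ i) \<phi> = 0"
      using g \<phi> by (simp add: L2inner_diff_left L2_component test_L2[OF lmeasurable_\<Omega>])
  qed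
  then have "AE x in lebesgue_on \<Omega>. \<forall>i. g x $ i - g' x $ i = 0"
    by (simp add: AE_all_countable)
  then show ?thesis by eventually_elim (simp add: vec_eq_iff)
qed

lemma has_weak_div_unique:
  assumes "has_weak_div \<Omega> \<tau> g" and "has_weak_div \<Omega> \<tau> g'"
  shows "AE x in lebesgue_on \<Omega>. g x = g' x"
proof -
  have g: "g \<in> L2 \<Omega>" "g' \<in> L2 \<Omega>" using assms by (auto simp: has_weak_div_def)
  have "AE x in lebesgue_on \<Omega>. g x - g' x = 0"
  proof (rule fundamental_lemma[OF open_\<Omega> lmeasurable_\<Omega>])
    show "(\<lambda>x. g x - g' x) \<in> L2 \<Omega>" by (intro L2_diff g)
    fix \<phi> assume \<phi>: "\<phi> \<in> test_functions \<Omega>"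
    have "L2inner \<Omega> g \<phi> = L2inner \<Omega> g' \<phi>"
      using assms \<phi> unfolding has_weak_div_iff by (metis minus_equation_iff)
    then show "L2inner \<Omega> (\<lambda>x. g x - g' x) \<phi> = 0"
      using g \<phi> by (simp add: L2inner_diff_left test_L2[OF lmeasurable_\<Omega>])
  qed
  then show ?thesis by eventually_elim simp
qed

lemma has_weak_grad_wgrad: "w \<in> H1 \<Omega> \<Longrightarrow> has_weak_grad \<Omega> w (wgrad \<Omega> w)"
  unfolding wgrad_def by (rule someI_ex[where P = "has_weak_grad \<Omega> w"]) (simp add: H1_def)

text \<open>Access to the choice operator: any gradient exhibited by hand may replace
  \<open>wgrad\<close>, up to a null set.\<close>

lemma wgrad_AE:
  assumes "w \<in> L2 \<Omega>" and "has_weak_grad \<Omega> w g"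
  shows "AE x in lebesgue_on \<Omega>. wgrad \<Omega> w x = g x"
  using assms by (intro has_weak_grad_unique[of w] has_weak_grad_wgrad) (auto simp: H1_def)

lemma has_weak_div_wdiv: "\<tau> \<in> Hdiv \<Omega> \<Longrightarrow> has_weak_div \<Omega> \<tau> (wdiv \<Omega> \<tau>)"
  unfolding wdiv_def by (rule someI_ex[where P = "has_weak_div \<Omega> \<tau>"]) (simp add: Hdiv_def)

lemma Hdiv_L2: "\<tau> \<in> Hdiv \<Omega> \<Longrightarrow> \<tau> \<in> L2 \<Omega>"
  by (simp add: Hdiv_def)

lemma wdiv_L2: "\<tau> \<in> Hdiv \<Omega> \<Longrightarrow> wdiv \<Omega> \<tau> \<in> L2 \<Omega>"
  using has_weak_div_wdiv by (auto simp: has_weak_div_def)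

lemma wdiv_AE:
  assumes "\<tau> \<in> L2 \<Omega>" and "has_weak_div \<Omega> \<tau> g"
  shows "AE x in lebesgue_on \<Omega>. wdiv \<Omega> \<tau> x = g x"
  using assms by (intro has_weak_div_unique[of \<tau>] has_weak_div_wdiv) (auto simp: Hdiv_def)

section \<open>The space \<open>H10\<close>: limits, linear combinations and Green's formula\<close>

lemma H10_H1: "w \<in> H10 \<Omega> \<Longrightarrow> w \<in> H1 \<Omega>"
  by (simp add: H10_def)

lemma H10_L2: "w \<in> H10 \<Omega> \<Longrightarrow> w \<in> L2 \<Omega>"
  by (simp add: H10_def H1_def)

lemma wgrad_L2: "w \<in> H10 \<Omega> \<Longrightarrow> wgrad \<Omega> w \<in> L2 \<Omega>"
  using has_weak_grad_wgrad[OF H10_H1] by (auto simp: has_weak_grad_def)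

text \<open>The weak gradient is a closed operator: both sides of its defining identity, tested with
  a fixed function, are continuous under L2 convergence.\<close>

lemma has_weak_grad_limit:
  assumes \<phi>: "\<And>n. \<phi> n \<in> test_functions \<Omega>" and w: "w \<in> L2 \<Omega>" and g: "g \<in> L2 \<Omega>"
    and lim_w: "(\<lambda>n. L2norm \<Omega> (\<lambda>x. \<phi> n x - w x)) \<longlonglongrightarrow> 0"
    and lim_g: "(\<lambda>n. L2norm \<Omega> (\<lambda>x. grad (\<phi> n) x - g x)) \<longlonglongrightarrow> 0"
  shows "has_weak_grad \<Omega> w g"
proof -
  note [simp] = test_L2[OF lmeasurable_\<Omega>] test_grad_L2[OF lmeasurable_\<Omega>]
  have "L2inner \<Omega> w (\<lambda>x. grad \<psi> x $ i) = - L2inner \<Omega> (\<lambda>x. g x $ i) \<psi>"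
    if \<psi>: "\<psi> \<in> test_functions \<Omega>" for \<psi> i
  proof (rule LIMSEQ_unique)
    have *: "L2inner \<Omega> (\<phi> n) (\<lambda>x. grad \<psi> x $ i) = - L2inner \<Omega> (\<lambda>x. grad (\<phi> n) x $ i) \<psi>" for n
      using has_weak_grad_test[OF lmeasurable_\<Omega> \<phi>] \<psi> \<phi>
      by (subst (asm) has_weak_grad_iff[OF lmeasurable_\<Omega>]) auto
    show "(\<lambda>n. L2inner \<Omega> (\<phi> n) (\<lambda>x. grad \<psi> x $ i)) \<longlonglongrightarrow> L2inner \<Omega> w (\<lambda>x. grad \<psi> x $ i)"
      using \<phi> \<psi> w lim_w by (intro tendsto_L2inner L2_component) auto
    have "(\<lambda>n. L2norm \<Omega> (\<lambda>x. grad (\<phi> n) x $ i - g x $ i)) \<longlonglongrightarrow> 0"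
    proof (rule Lim_null_comparison[OF always_eventually lim_g], intro allI)
      fix n
      have "L2norm \<Omega> (\<lambda>x. grad (\<phi> n) x $ i - g x $ i) \<le> L2norm \<Omega> (\<lambda>x. grad (\<phi> n) x - g x)"
        using component_le_norm_cart[of "grad (\<phi> n) x - g x" i for x]
        by (intro L2norm_mono L2_diff L2_component) (auto simp: \<phi> g)
      then show "norm (L2norm \<Omega> (\<lambda>x. grad (\<phi> n) x $ i - g x $ i))
          \<le> L2norm \<Omega> (\<lambda>x. grad (\<phi> n) x - g x)" by simp
    qed
    then have "(\<lambda>n. L2inner \<Omega> (\<lambda>x. grad (\<phi> n) x $ i) \<psi>) \<longlonglongrightarrow> L2inner \<Omega> (\<lambda>x. g x $ i) \<psi>"
      using \<phi> \<psi> g by (intro tendsto_L2inner L2_component) auto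
    then show "(\<lambda>n. L2inner \<Omega> (\<phi> n) (\<lambda>x. grad \<psi> x $ i)) \<longlonglongrightarrow> - L2inner \<Omega> (\<lambda>x. g x $ i) \<psi>"
      unfolding * by (rule tendsto_minus)
  qed
  then show ?thesis using has_weak_grad_iff[OF lmeasurable_\<Omega> w g] by blast
qed

text \<open>\<open>H10\<close> speaks about \<open>wgrad\<close>, which is of no use for
  constructing elements. Here any L2 limit of the gradients will do, and it is identified with
  \<open>wgrad\<close> afterwards.\<close>

lemma H10_limit:
  assumes \<phi>: "\<And>n. \<phi> n \<in> test_functions \<Omega>" and w: "w \<in> L2 \<Omega>" and g: "g \<in> L2 \<Omega>"
    and lim_w: "(\<lambda>n. L2norm \<Omega> (\<lambda>x. \<phi> n x - w x)) \<longlonglongrightarrow> 0"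
    and lim_g: "(\<lambda>n. L2norm \<Omega> (\<lambda>x. grad (\<phi> n) x - g x)) \<longlonglongrightarrow> 0"
  shows "w \<in> H10 \<Omega>" and "AE x in lebesgue_on \<Omega>. wgrad \<Omega> w x = g x"
proof -
  have wg: "has_weak_grad \<Omega> w g" by (rule has_weak_grad_limit[OF assms])
  then have H1: "w \<in> H1 \<Omega>" using w by (auto simp: H1_def)
  show ae: "AE x in lebesgue_on \<Omega>. wgrad \<Omega> w x = g x" by (rule wgrad_AE[OF w wg])
  have "wgrad \<Omega> w \<in> L2 \<Omega>" using has_weak_grad_wgrad[OF H1] by (simp add: has_weak_grad_def)
  then have "L2norm \<Omega> (\<lambda>x. grad (\<phi> n) x - wgrad \<Omega> w x) = L2norm \<Omega> (\<lambda>x. grad (\<phi> n) x - g x)" for n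
    using ae g test_grad_L2[OF lmeasurable_\<Omega> \<phi>]
    by (intro L2norm_cong_AE L2_diff) auto
  then show "w \<in> H10 \<Omega>" using H1 \<phi> lim_w lim_g unfolding H10_def by (auto intro!: exI[of _ \<phi>])
qed

lemma H10_approx:
  assumes "w \<in> H10 \<Omega>"
  obtains \<phi> where "\<And>n. \<phi> n \<in> test_functions \<Omega>"
    and "(\<lambda>n. L2norm \<Omega> (\<lambda>x. \<phi> n x - w x)) \<longlonglongrightarrow> 0"
    and "(\<lambda>n. L2norm \<Omega> (\<lambda>x. grad (\<phi> n) x - wgrad \<Omega> w x)) \<longlonglongrightarrow> 0"
  using assms by (auto simp: H10_def)

lemma test_H10:
  assumes "\<phi> \<in> test_functions \<Omega>"
  shows "\<phi> \<in> H10 \<Omega>" and "AE x in lebesgue_on \<Omega>. wgrad \<Omega> \<phi> x = grad \<phi> x"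
  using assms by (auto intro!: H10_limit[of "\<lambda>_. \<phi>"] test_L2 test_grad_L2 lmeasurable_\<Omega>)

lemma H10_lincomb:
  assumes v: "v \<in> H10 \<Omega>" and w: "w \<in> H10 \<Omega>"
  shows "(\<lambda>x. v x + c * w x) \<in> H10 \<Omega>"
    and "AE x in lebesgue_on \<Omega>. wgrad \<Omega> (\<lambda>x. v x + c * w x) x = wgrad \<Omega> v x + c *\<^sub>R wgrad \<Omega> w x"
proof -
  note [simp] = test_L2[OF lmeasurable_\<Omega>] test_grad_L2[OF lmeasurable_\<Omega>] v w H10_L2 wgrad_L2
  obtain \<phi> where \<phi>[simp]: "\<And>n. \<phi> n \<in> test_functions \<Omega>"
    and \<phi>_lim: "(\<lambda>n. L2norm \<Omega> (\<lambda>x. \<phi> n x - v x)) \<longlonglongrightarrow> 0"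
      "(\<lambda>n. L2norm \<Omega> (\<lambda>x. grad (\<phi> n) x - wgrad \<Omega> v x)) \<longlonglongrightarrow> 0"
    using H10_approx[OF v] by blast
  obtain \<psi> where \<psi>[simp]: "\<And>n. \<psi> n \<in> test_functions \<Omega>"
    and \<psi>_lim: "(\<lambda>n. L2norm \<Omega> (\<lambda>x. \<psi> n x - w x)) \<longlonglongrightarrow> 0"
      "(\<lambda>n. L2norm \<Omega> (\<lambda>x. grad (\<psi> n) x - wgrad \<Omega> w x)) \<longlonglongrightarrow> 0"
    using H10_approx[OF w] by blast
  \<comment> \<open>Stated for a general codomain because it serves both the scalar functions and
    their gradients.\<close>
  have lim: "(\<lambda>n. L2norm \<Omega> (\<lambda>x. (F n x + c *\<^sub>R G n x) - (f x + c *\<^sub>R g x))) \<longlonglongrightarrow> 0"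
    if "\<And>n. F n \<in> L2 \<Omega>" "\<And>n. G n \<in> L2 \<Omega>" "f \<in> L2 \<Omega>" "g \<in> L2 \<Omega>"
      and F: "(\<lambda>n. L2norm \<Omega> (\<lambda>x. F n x - f x)) \<longlonglongrightarrow> 0"
      and G: "(\<lambda>n. L2norm \<Omega> (\<lambda>x. G n x - g x)) \<longlonglongrightarrow> 0"
    for F G :: "nat \<Rightarrow> real^'d \<Rightarrow> 'b::euclidean_space" and f g
  proof (rule Lim_null_comparison[OF always_eventually], intro allI)
    fix n
    have "L2norm \<Omega> (\<lambda>x. (F n x - f x) + c *\<^sub>R (G n x - g x))
        \<le> L2norm \<Omega> (\<lambda>x. F n x - f x) + L2norm \<Omega> (\<lambda>x. c *\<^sub>R (G n x - g x))"
      using that by (intro L2norm_triangle L2_diff L2_scaleR)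
    moreover have "(\<lambda>x. (F n x - f x) + c *\<^sub>R (G n x - g x))
        = (\<lambda>x. (F n x + c *\<^sub>R G n x) - (f x + c *\<^sub>R g x))"
      by (simp add: algebra_simps)
    ultimately show "norm (L2norm \<Omega> (\<lambda>x. (F n x + c *\<^sub>R G n x) - (f x + c *\<^sub>R g x)))
        \<le> L2norm \<Omega> (\<lambda>x. F n x - f x) + \<bar>c\<bar> * L2norm \<Omega> (\<lambda>x. G n x - g x)"
      by (simp only: L2norm_scaleR real_norm_def abs_of_nonneg[OF L2norm_nonneg])
    show "(\<lambda>n. L2norm \<Omega> (\<lambda>x. F n x - f x) + \<bar>c\<bar> * L2norm \<Omega> (\<lambda>x. G n x - g x)) \<longlonglongrightarrow> 0"
      using tendsto_add[OF F tendsto_mult_right_zero[OF G, of "\<bar>c\<bar>"]] by simp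
  qed
  have 1: "(\<lambda>n. L2norm \<Omega> (\<lambda>x. (\<phi> n x + c * \<psi> n x) - (v x + c * w x))) \<longlonglongrightarrow> 0"
    using lim[OF _ _ _ _ \<phi>_lim(1) \<psi>_lim(1)] by simp
  have 2: "(\<lambda>n. L2norm \<Omega> (\<lambda>x. grad (\<lambda>x. \<phi> n x + c * \<psi> n x) x
      - (wgrad \<Omega> v x + c *\<^sub>R wgrad \<Omega> w x))) \<longlonglongrightarrow> 0"
    using lim[OF _ _ _ _ \<phi>_lim(2) \<psi>_lim(2)] by (simp add: grad_lincomb[OF \<phi> \<psi>])
  show "(\<lambda>x. v x + c * w x) \<in> H10 \<Omega>"
    "AE x in lebesgue_on \<Omega>. wgrad \<Omega> (\<lambda>x. v x + c * w x) x = wgrad \<Omega> v x + c *\<^sub>R wgrad \<Omega> w x"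
    by (rule H10_limit[OF _ _ _ 1 2]; simp add: test_lincomb L2_add L2_mult L2_scaleR)+
qed

lemma H10_diff:
  assumes "v \<in> H10 \<Omega>" and "w \<in> H10 \<Omega>"
  shows "(\<lambda>x. v x - w x) \<in> H10 \<Omega>"
    and "AE x in lebesgue_on \<Omega>. wgrad \<Omega> (\<lambda>x. v x - w x) x = wgrad \<Omega> v x - wgrad \<Omega> w x"
  using H10_lincomb[OF assms, of "-1"] by simp_all

text \<open>Density: both sides are continuous in w for the H1 norm. It serves Green's formula and
  the weak equation alike.\<close>

lemma test_identity_extends:
  assumes F: "F \<in> L2 \<Omega>" and k: "k \<in> L2 \<Omega>" and w: "w \<in> H10 \<Omega>"
    and eq: "\<And>\<phi>. \<phi> \<in> test_functions \<Omega> \<Longrightarrow> L2inner \<Omega> F (grad \<phi>) = L2inner \<Omega> k \<phi>"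
  shows "L2inner \<Omega> F (wgrad \<Omega> w) = L2inner \<Omega> k w"
proof -
  obtain \<phi> where \<phi>: "\<And>n. \<phi> n \<in> test_functions \<Omega>"
    and lim: "(\<lambda>n. L2norm \<Omega> (\<lambda>x. \<phi> n x - w x)) \<longlonglongrightarrow> 0"
      "(\<lambda>n. L2norm \<Omega> (\<lambda>x. grad (\<phi> n) x - wgrad \<Omega> w x)) \<longlonglongrightarrow> 0"
    using H10_approx[OF w] by blast
  have "(\<lambda>n. L2inner \<Omega> F (grad (\<phi> n))) \<longlonglongrightarrow> L2inner \<Omega> F (wgrad \<Omega> w)"
    unfolding L2inner_commute[of \<Omega> F]
    by (intro tendsto_L2inner lim F wgrad_L2 w test_grad_L2 \<phi> lmeasurable_\<Omega>)
  moreover have "(\<lambda>n. L2inner \<Omega> F (grad (\<phi> n))) \<longlonglongrightarrow> L2inner \<Omega> k w"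
    unfolding eq[OF \<phi>] L2inner_commute[of \<Omega> k]
    by (intro tendsto_L2inner lim k H10_L2 w test_L2 \<phi> lmeasurable_\<Omega>)
  ultimately show ?thesis by (rule LIMSEQ_unique)
qed

text \<open>There is no boundary term because w is a limit of test functions.\<close>

lemma Green_formula:
  assumes "\<tau> \<in> Hdiv \<Omega>" and "w \<in> H10 \<Omega>"
  shows "L2inner \<Omega> \<tau> (wgrad \<Omega> w) = - L2inner \<Omega> (wdiv \<Omega> \<tau>) w"
proof -
  have "L2inner \<Omega> \<tau> (wgrad \<Omega> w) = L2inner \<Omega> (\<lambda>x. - wdiv \<Omega> \<tau> x) w"
    using has_weak_div_wdiv[OF assms(1)] unfolding has_weak_div_iff
    by (intro test_identity_extends L2_uminus Hdiv_L2 wdiv_L2 assms) (simp add: L2inner_minus_left)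
  then show ?thesis by (simp add: L2inner_minus_left)
qed

end

section \<open>Weak solutions\<close>

text \<open>Riesz representation without completeness: a minimising sequence of \<open>J v = B v v / 2 - l v\<close>
  satisfies \<open>(B (s n) v - l v)\<^sup>2 \<le> 2 \<epsilon>\<^sub>n B v v\<close>, because \<open>J (s n + t v) \<ge> inf J\<close> for all \<open>t\<close>;
  taking \<open>v = s m - s n\<close> shows that it is a Cauchy sequence.\<close>

lemma Riesz_approximation:
  fixes V :: "'a set" and B :: "'a \<Rightarrow> 'a \<Rightarrow> real" and l :: "'a \<Rightarrow> real"
    and comb :: "'a \<Rightarrow> real \<Rightarrow> 'a \<Rightarrow> 'a"
  assumes ne: "V \<noteq> {}"
    and comb: "\<And>v w c. v \<in> V \<Longrightarrow> w \<in> V \<Longrightarrow> comb v c w \<in> V"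
    and B_comb: "\<And>u v w c. u \<in> V \<Longrightarrow> v \<in> V \<Longrightarrow> w \<in> V \<Longrightarrow> B (comb v c w) u = B v u + c * B w u"
    and B_commute: "\<And>v w. v \<in> V \<Longrightarrow> w \<in> V \<Longrightarrow> B v w = B w v"
    and B_nonneg: "\<And>v. v \<in> V \<Longrightarrow> 0 \<le> B v v"
    and l_comb: "\<And>v w c. v \<in> V \<Longrightarrow> w \<in> V \<Longrightarrow> l (comb v c w) = l v + c * l w"
    and l_bound: "\<And>v. v \<in> V \<Longrightarrow> (l v)\<^sup>2 \<le> K * B v v" and "0 \<le> K"
  obtains s :: "nat \<Rightarrow> 'a" where "\<And>n. s n \<in> V"
    and "\<And>v. v \<in> V \<Longrightarrow> (\<lambda>n. B (s n) v) \<longlonglongrightarrow> l v"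
    and "\<And>m n. B (comb (s m) (-1) (s n)) (comb (s m) (-1) (s n))
      \<le> 4 * (inverse (real (Suc m)) + inverse (real (Suc n)))"
proof -
  define J where "J v = B v v / 2 - l v" for v
  define \<epsilon> where "\<epsilon> n = inverse (real (Suc n))" for n
  \<comment> \<open>The square of \<open>l v\<close> is at most the product of \<open>K\<close> and
    \<open>B v v\<close>, and the geometric mean is at most the arithmetic one.\<close>
  have lower: "- K / 2 \<le> J v" if "v \<in> V" for v
  proof -
    have "K * B v v \<le> ((K + B v v) / 2)\<^sup>2"
      using zero_le_power2[of "K - B v v"] by (simp add: power2_eq_square field_simps)
    then have "(l v)\<^sup>2 \<le> ((K + B v v) / 2)\<^sup>2" using l_bound[OF that] by linarith
    then have "l v \<le> (K + B v v) / 2"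
      by (rule power2_le_imp_le) (use \<open>0 \<le> K\<close> B_nonneg[OF that] in auto)
    then show ?thesis by (simp add: J_def field_simps)
  qed
  define m where "m = Inf (J ` V)"
  have m_le: "m \<le> J v" if "v \<in> V" for v
    unfolding m_def using lower that by (intro cInf_lower bdd_belowI2) auto
  have "\<exists>v\<in>V. J v < m + \<epsilon> n" for n
    using cInf_lessD[of "J ` V" "m + \<epsilon> n"] ne by (auto simp: m_def \<epsilon>_def)
  then obtain s where s: "\<And>n. s n \<in> V" "\<And>n. J (s n) < m + \<epsilon> n" by metis
  have J_comb: "J (comb v t w) = J v + t * (B v w - l w) + t\<^sup>2 * B w w / 2"
    if "v \<in> V" "w \<in> V" for v w t
  proof -
    have "B (comb v t w) (comb v t w) = B v v + 2 * t * B v w + t\<^sup>2 * B w w"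
      using that by (simp add: B_comb comb B_commute[of v "comb v t w"] B_commute[of w "comb v t w"]
          B_commute[of w v] power2_eq_square algebra_simps)
    then show ?thesis using that by (simp add: J_def l_comb algebra_simps add_divide_distrib)
  qed
  have est: "(B (s n) v - l v)\<^sup>2 \<le> 2 * \<epsilon> n * B v v" if v: "v \<in> V" for n v
  proof -
    define a b where "a = B (s n) v - l v" and "b = B v v"
    have q: "- \<epsilon> n \<le> t * a + t\<^sup>2 * b / 2" for t
      using m_le[OF comb[OF s(1) v], of n t] s(2)[of n] J_comb[OF s(1) v, of n t]
      by (simp add: a_def b_def)
    have "b \<ge> 0" unfolding b_def by (rule B_nonneg[OF v])
    have "a\<^sup>2 \<le> 2 * \<epsilon> n * b"
    proof (cases "b = 0")
      case True
      \<comment> \<open>\<open>B\<close> may be degenerate. For b = 0 the bound \<open>q\<close> is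
        linear in t and would fail at t = -(\<epsilon> n + 1)/a.\<close>
      have "a = 0"
      proof (rule ccontr)
        assume "a \<noteq> 0"
        then show False using q[of "- (\<epsilon> n + 1) / a"] True by simp
      qed
      then show ?thesis using True by simp
    next
      case False
      with \<open>b \<ge> 0\<close> have "b > 0" by simp
      \<comment> \<open>The quadratic in \<open>q\<close> is minimal at t = - a/b.\<close>
      have "- a / b * a + (- a / b)\<^sup>2 * b / 2 = - (a\<^sup>2 / (2 * b))"
        using \<open>b > 0\<close> by (simp add: field_simps power2_eq_square)
      then have "a\<^sup>2 / (2 * b) \<le> \<epsilon> n" using q[of "- a / b"] by simp
      then show ?thesis using \<open>b > 0\<close> by (simp add: field_simps)
    qed
    then show ?thesis by (simp add: a_def b_def)
  qed
  have "(\<lambda>n. B (s n) v) \<longlonglongrightarrow> l v" if v: "v \<in> V" for v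
  proof -
    have "(\<lambda>n. (B (s n) v - l v)\<^sup>2) \<longlonglongrightarrow> 0"
    proof (rule Lim_null_comparison)
      show "\<forall>\<^sub>F n in sequentially. norm ((B (s n) v - l v)\<^sup>2) \<le> 2 * \<epsilon> n * B v v"
        using est[OF v] by (intro always_eventually) simp
      have "(\<lambda>n. 2 * \<epsilon> n * B v v) \<longlonglongrightarrow> 2 * 0 * B v v"
        unfolding \<epsilon>_def by (intro tendsto_intros LIMSEQ_inverse_real_of_nat)
      then show "(\<lambda>n. 2 * \<epsilon> n * B v v) \<longlonglongrightarrow> 0" by simp
    qed
    then have "(\<lambda>n. B (s n) v - l v) \<longlonglongrightarrow> 0" by simp
    then show ?thesis by (simp add: LIM_zero_iff)
  qed
  moreover have "B (comb (s i) (-1) (s j)) (comb (s i) (-1) (s j)) \<le> 4 * (\<epsilon> i + \<epsilon> j)" for i j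
  proof -
    define v where "v = comb (s i) (-1) (s j)"
    have v: "v \<in> V" unfolding v_def by (intro comb s)
    define p q where "p = B (s i) v - l v" and "q = B (s j) v - l v"
    \<comment> \<open>\<open>v\<close> is the difference of \<open>s i\<close> and
      \<open>s j\<close>, so \<open>B v v\<close> is the difference of two errors of the kind
      bounded by \<open>est\<close>; the term \<open>l v\<close> cancels.\<close>
    have pq: "B v v = p - q"
      unfolding p_def q_def using B_comb[OF v s(1) s(1), of i "-1" j] by (simp add: v_def)
    have "(p - q)\<^sup>2 \<le> 2 * p\<^sup>2 + 2 * q\<^sup>2"
      using zero_le_power2[of "p + q"] by (simp add: power2_eq_square algebra_simps)
    then have "B v v * B v v \<le> 4 * (\<epsilon> i + \<epsilon> j) * B v v"
      using est[OF v, of i] est[OF v, of j] unfolding pq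
      by (simp add: p_def[symmetric] q_def[symmetric] power2_eq_square algebra_simps)
    moreover have "0 \<le> 4 * (\<epsilon> i + \<epsilon> j)" by (simp add: \<epsilon>_def)
    \<comment> \<open>A positive factor \<open>B v v\<close> can be cancelled; if it is 0, the claim
      is trivial.\<close>
    ultimately show ?thesis
      using B_nonneg[OF v] unfolding v_def[symmetric]
      by (metis mult_right_le_imp_le order_le_less)
  qed
  ultimately show ?thesis using that s(1) unfolding \<epsilon>_def by blast
qed

locale elliptic_problem = bounded_open_set \<Omega> for \<Omega> :: "(real^'d) set" +
  fixes \<nu> :: "real^'d \<Rightarrow> real" and \<nu>l \<nu>u C :: real
  assumes \<nu>_measurable: "\<nu> \<in> borel_measurable (lebesgue_on \<Omega>)"
    and \<nu>l_pos: "0 < \<nu>l" and \<nu>_bounds: "\<And>x. x \<in> \<Omega> \<Longrightarrow> \<nu>l \<le> \<nu> x \<and> \<nu> x \<le> \<nu>u"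
    and C_pos: "0 < C"
    and Friedrichs: "\<And>w. w \<in> H10 \<Omega> \<Longrightarrow> L2norm \<Omega> w \<le> C * L2norm \<Omega> (wgrad \<Omega> w)"
begin

text \<open>The energy product acts on vector fields instead of functions, so that it accepts both
  the classical gradients of test functions and weak gradients.\<close>

definition form :: "(real^'d \<Rightarrow> real^'d) \<Rightarrow> (real^'d \<Rightarrow> real^'d) \<Rightarrow> real" where
  "form F G = L2inner \<Omega> (\<lambda>x. \<nu> x *\<^sub>R F x) G"

lemma \<nu>_L2:
  fixes F :: "real^'d \<Rightarrow> real^'d"
  shows "F \<in> L2 \<Omega> \<Longrightarrow> (\<lambda>x. \<nu> x *\<^sub>R F x) \<in> L2 \<Omega>"
  using \<nu>_measurable by (rule L2_bounded_mult[where B = \<nu>u]) (use \<nu>_bounds \<nu>l_pos in fastforce)+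

lemma form_commute: "form F G = form G F"
  by (simp add: form_def L2inner_def inner_commute)

lemma form_alt: "form F G = L2inner \<Omega> F (\<lambda>x. \<nu> x *\<^sub>R G x)"
  by (simp add: form_def L2inner_def)

lemma form_cong_AE:
  assumes "AE x in lebesgue_on \<Omega>. F x = F' x" and "F \<in> L2 \<Omega>" "F' \<in> L2 \<Omega>" "G \<in> L2 \<Omega>"
  shows "form F G = form F' G"
  unfolding form_alt using assms by (intro L2inner_cong_AE \<nu>_L2) auto

lemma form_lincomb_left:
  assumes "F \<in> L2 \<Omega>" and "G \<in> L2 \<Omega>" and "H \<in> L2 \<Omega>"
  shows "form (\<lambda>x. F x + c *\<^sub>R G x) H = form F H + c * form G H"
  using assms by (simp add: form_alt L2inner_add_left L2inner_scaleR_left L2_scaleR \<nu>_L2)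

lemma form_diff_left:
  assumes "F \<in> L2 \<Omega>" and "G \<in> L2 \<Omega>" and "H \<in> L2 \<Omega>"
  shows "form (\<lambda>x. F x - G x) H = form F H - form G H"
  using form_lincomb_left[OF assms, of "-1"] by simp

lemma form_coercive:
  assumes "F \<in> L2 \<Omega>"
  shows "\<nu>l * (L2norm \<Omega> F)\<^sup>2 \<le> form F F"
proof -
  have "L2inner \<Omega> (\<lambda>x. \<nu>l *\<^sub>R F x) F \<le> L2inner \<Omega> (\<lambda>x. \<nu> x *\<^sub>R F x) F"
    unfolding L2inner_def
  proof (rule integral_mono)
    show "(\<nu>l *\<^sub>R F x) \<bullet> F x \<le> (\<nu> x *\<^sub>R F x) \<bullet> F x" if "x \<in> space (lebesgue_on \<Omega>)" for x
      using \<nu>_bounds[of x] that by (simp add: mult_right_mono)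
  qed (intro L2_inner_integrable L2_scaleR \<nu>_L2 assms)+
  then show ?thesis by (simp add: form_def L2norm_power2 L2inner_scaleR_left)
qed

lemma weak_solution_iff:
  "weak_solution \<Omega> \<nu> g y \<longleftrightarrow>
    y \<in> H10 \<Omega> \<and> (\<forall>w \<in> H10 \<Omega>. form (wgrad \<Omega> y) (wgrad \<Omega> w) = L2inner \<Omega> g w)"
  by (simp add: weak_solution_def form_def L2inner_def)

section \<open>Existence of weak solutions\<close>

lemma Friedrichs_test:
  assumes "\<phi> \<in> test_functions \<Omega>"
  shows "L2norm \<Omega> \<phi> \<le> C * L2norm \<Omega> (grad \<phi>)"
proof -
  have "L2norm \<Omega> (wgrad \<Omega> \<phi>) = L2norm \<Omega> (grad \<phi>)"
    by (intro L2norm_cong_AE test_H10 wgrad_L2 test_grad_L2 lmeasurable_\<Omega> assms)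
  then show ?thesis using Friedrichs[OF test_H10(1)[OF assms]] by simp
qed

text \<open>The Riesz argument runs over test functions only: there \<open>grad\<close> is classical
  and linear at every point, so its algebraic hypotheses are plain equations. The limit is taken in
  L2, separately for the functions and their gradients, and density then extends the equation to all
  of \<open>H10\<close>.\<close>

theorem weak_solution_exists:
  assumes h: "h \<in> L2 \<Omega>"
  shows "\<exists>z. weak_solution \<Omega> \<nu> h z"
proof -
  note [simp] = test_L2[OF lmeasurable_\<Omega>] test_grad_L2[OF lmeasurable_\<Omega>] h
  have 1: "form (grad (\<lambda>x. v x + c * w x)) (grad u) = form (grad v) (grad u) + c * form (grad w) (grad u)"
    if [simp]: "u \<in> test_functions \<Omega>" "v \<in> test_functions \<Omega>" "w \<in> test_functions \<Omega>" for u v w c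
  proof -
    have "grad (\<lambda>x. v x + c * w x) = (\<lambda>x. grad v x + c *\<^sub>R grad w x)"
      by (rule ext) (rule grad_lincomb[OF that(2,3)])
    then show ?thesis by (simp add: form_lincomb_left)
  qed
  have 2: "(L2inner \<Omega> h v)\<^sup>2 \<le> (L2norm \<Omega> h)\<^sup>2 * C\<^sup>2 / \<nu>l * form (grad v) (grad v)"
    if [simp]: "v \<in> test_functions \<Omega>" for v
  proof -
    have "\<bar>L2inner \<Omega> h v\<bar> \<le> L2norm \<Omega> h * (C * L2norm \<Omega> (grad v))"
      using L2_Cauchy_Schwarz[of h \<Omega> v] mult_left_mono[OF Friedrichs_test, of v "L2norm \<Omega> h"] by simp
    then have "(L2inner \<Omega> h v)\<^sup>2 \<le> (L2norm \<Omega> h * (C * L2norm \<Omega> (grad v)))\<^sup>2"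
      by (metis abs_ge_zero power2_abs power_mono)
    also have "\<dots> = (L2norm \<Omega> h)\<^sup>2 * C\<^sup>2 / \<nu>l * (\<nu>l * (L2norm \<Omega> (grad v))\<^sup>2)"
      using \<nu>l_pos by (simp add: power_mult_distrib)
    also have "\<dots> \<le> (L2norm \<Omega> h)\<^sup>2 * C\<^sup>2 / \<nu>l * form (grad v) (grad v)"
      using \<nu>l_pos by (intro mult_left_mono form_coercive) auto
    finally show ?thesis .
  qed
  have 3: "0 \<le> form (grad v) (grad v)" if "v \<in> test_functions \<Omega>" for v
    using form_coercive[of "grad v"] that \<nu>l_pos
    by (meson order_trans mult_nonneg_nonneg less_imp_le zero_le_power2 test_grad_L2 lmeasurable_\<Omega>)
  obtain s where s: "\<And>n. s n \<in> test_functions \<Omega>"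
    and s_lim: "\<And>v. v \<in> test_functions \<Omega> \<Longrightarrow> (\<lambda>n. form (grad (s n)) (grad v)) \<longlonglongrightarrow> L2inner \<Omega> h v"
    and s_Cauchy: "\<And>m n. form (grad (\<lambda>x. s m x + (-1) * s n x)) (grad (\<lambda>x. s m x + (-1) * s n x))
      \<le> 4 * (inverse (real (Suc m)) + inverse (real (Suc n)))"
  proof (rule Riesz_approximation[where V = "test_functions \<Omega>" and l = "L2inner \<Omega> h"
        and B = "\<lambda>v w. form (grad v) (grad w)" and comb = "\<lambda>v c w x. v x + c * w x"
        and K = "(L2norm \<Omega> h)\<^sup>2 * C\<^sup>2 / \<nu>l"])
    show "test_functions \<Omega> \<noteq> {}"
      using test_functionsI[of "\<lambda>x. 0" "{}" \<Omega>] Ck_const by auto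
    show "L2inner \<Omega> h (\<lambda>x. v x + c * w x) = L2inner \<Omega> h v + c * L2inner \<Omega> h w"
      if "v \<in> test_functions \<Omega>" "w \<in> test_functions \<Omega>" for v w c
      using that by (simp add: L2inner_add_right L2inner_mult_right L2_mult)
    show "(L2inner \<Omega> h v)\<^sup>2 \<le> (L2norm \<Omega> h)\<^sup>2 * C\<^sup>2 / \<nu>l * form (grad v) (grad v)"
      if "v \<in> test_functions \<Omega>" for v by (rule 2[OF that])
  qed (use \<nu>l_pos in \<open>auto intro: test_lincomb form_commute 1 3\<close>)
  have eq: "grad (\<lambda>x. s m x + (-1) * s n x) = (\<lambda>x. grad (s m) x - grad (s n) x)" for m n
    by (rule ext) (subst grad_lincomb[OF s s], simp)
  \<comment> \<open>Coercivity turns the energy bound for the minimising sequence into an L2 bound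
    for gradients, hence the tolerance \<open>\<nu>l * e\<^sup>2\<close>.\<close>
  have grad_s: "L2norm \<Omega> (\<lambda>x. grad (s m) x - grad (s n) x) \<le> e"
    if e: "e > 0" and mn: "4 * (inverse (real (Suc m)) + inverse (real (Suc n))) \<le> \<nu>l * e\<^sup>2" for m n e
  proof -
    have "\<nu>l * (L2norm \<Omega> (\<lambda>x. grad (s m) x - grad (s n) x))\<^sup>2 \<le> \<nu>l * e\<^sup>2"
      using form_coercive[OF L2_diff[OF test_grad_L2[OF lmeasurable_\<Omega> s] test_grad_L2[OF lmeasurable_\<Omega> s]],
          of m n] s_Cauchy[of m n, unfolded eq] mn by linarith
    then have "(L2norm \<Omega> (\<lambda>x. grad (s m) x - grad (s n) x))\<^sup>2 \<le> e\<^sup>2" using \<nu>l_pos by simp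
    then show ?thesis by (rule power2_le_imp_le) (use e in simp)
  qed
  have small: "\<exists>N. \<forall>m\<ge>N. \<forall>n\<ge>N. 4 * (inverse (real (Suc m)) + inverse (real (Suc n))) \<le> d" if d: "d > 0" for d
  proof -
    \<comment> \<open>Two summands of at most d/8, multiplied by 4, give d.\<close>
    obtain N where N: "inverse (real (Suc N)) < d / 8"
      using reals_Archimedean[of "d / 8"] d by auto
    have "inverse (real (Suc m)) \<le> d / 8" if "m \<ge> N" for m
    proof -
      have "inverse (real (Suc m)) \<le> inverse (real (Suc N))"
        using that by (intro le_imp_inverse_le) auto
      then show ?thesis using N by linarith
    qed
    then have "4 * (inverse (real (Suc m)) + inverse (real (Suc n))) \<le> d" if "m \<ge> N" "n \<ge> N" for m n
      using that add_mono[of "inverse (real (Suc m))" "d/8" "inverse (real (Suc n))" "d/8"] by fastforce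
    then show ?thesis by blast
  qed
  have grad_Cauchy: "\<exists>N. \<forall>m\<ge>N. \<forall>n\<ge>N. L2norm \<Omega> (\<lambda>x. grad (s m) x - grad (s n) x) \<le> e" if "e > 0" for e
    using small[of "\<nu>l * e\<^sup>2"] grad_s[OF that] \<nu>l_pos that by (metis mult_pos_pos zero_less_power)
  have s_Cauchy': "\<exists>N. \<forall>m\<ge>N. \<forall>n\<ge>N. L2norm \<Omega> (\<lambda>x. s m x - s n x) \<le> e" if e: "e > 0" for e
  proof -
    have "e / C > 0" using e C_pos by simp
    then obtain N where N: "\<And>m n. m \<ge> N \<Longrightarrow> n \<ge> N \<Longrightarrow> L2norm \<Omega> (\<lambda>x. grad (s m) x - grad (s n) x) \<le> e / C"
      using grad_Cauchy by meson
    have "L2norm \<Omega> (\<lambda>x. s m x - s n x) \<le> e" if mn: "m \<ge> N" "n \<ge> N" for m n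
    proof -
      have "L2norm \<Omega> (\<lambda>x. s m x - s n x) \<le> C * L2norm \<Omega> (\<lambda>x. grad (s m) x - grad (s n) x)"
        using Friedrichs_test[OF test_lincomb[OF s s, of m "-1" n]] unfolding eq by simp
      also have "\<dots> \<le> C * (e / C)" using N[OF mn] C_pos by (intro mult_left_mono) auto
      finally show ?thesis using C_pos by simp
    qed
    then show ?thesis by blast
  qed
  obtain z where z: "z \<in> L2 \<Omega>" "(\<lambda>n. L2norm \<Omega> (\<lambda>x. s n x - z x)) \<longlonglongrightarrow> 0"
    using L2_complete[OF lmeasurable_\<Omega>, of s] s s_Cauchy' by auto
  obtain g where g: "g \<in> L2 \<Omega>" "(\<lambda>n. L2norm \<Omega> (\<lambda>x. grad (s n) x - g x)) \<longlonglongrightarrow> 0"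
    using L2_complete[OF lmeasurable_\<Omega>, of "\<lambda>n. grad (s n)"] s grad_Cauchy by auto
  note H10 = H10_limit[OF s z(1) g(1) z(2) g(2)]
  have "form (wgrad \<Omega> z) (grad v) = L2inner \<Omega> h v" if v: "v \<in> test_functions \<Omega>" for v
  proof -
    have "(\<lambda>n. form (grad (s n)) (grad v)) \<longlonglongrightarrow> form g (grad v)"
      unfolding form_alt using s v g by (intro tendsto_L2inner \<nu>_L2) auto
    then have "form g (grad v) = L2inner \<Omega> h v" using s_lim[OF v] by (rule LIMSEQ_unique)
    then show ?thesis using form_cong_AE[OF H10(2) wgrad_L2[OF H10(1)] g(1)] v by simp
  qed
  then have "form (wgrad \<Omega> z) (wgrad \<Omega> w) = L2inner \<Omega> h w" if "w \<in> H10 \<Omega>" for w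
    unfolding form_def using that H10(1)
    by (intro test_identity_extends \<nu>_L2 wgrad_L2) auto
  then show ?thesis using H10(1) weak_solution_iff by blast
qed

text \<open>Friedrichs' inequality replaces the norm of d by that of its gradient, which then
  cancels. The estimate is used for the error of an approximate state, and with q = 0 for the effect
  of a perturbed control.\<close>

lemma energy_estimate:
  assumes d: "d \<in> H10 \<Omega>" and r: "r \<in> L2 \<Omega>" and q: "q \<in> L2 \<Omega>"
    and eq: "form (wgrad \<Omega> d) (wgrad \<Omega> d) = L2inner \<Omega> r d + L2inner \<Omega> q (wgrad \<Omega> d)"
  shows "\<nu>l * L2norm \<Omega> (wgrad \<Omega> d) \<le> C * L2norm \<Omega> r + L2norm \<Omega> q"
proof (cases "L2norm \<Omega> (wgrad \<Omega> d) = 0")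
  case True
  then show ?thesis using C_pos by simp
next
  case False
  define D where "D = L2norm \<Omega> (wgrad \<Omega> d)"
  have D: "D > 0" using False by (simp add: D_def order_less_le)
  have "\<nu>l * D\<^sup>2 \<le> form (wgrad \<Omega> d) (wgrad \<Omega> d)"
    unfolding D_def by (rule form_coercive[OF wgrad_L2[OF d]])
  also have "\<dots> \<le> L2norm \<Omega> r * L2norm \<Omega> d + L2norm \<Omega> q * D"
    unfolding eq D_def using L2_Cauchy_Schwarz[OF r H10_L2[OF d]] L2_Cauchy_Schwarz[OF q wgrad_L2[OF d]]
    by linarith
  also have "\<dots> \<le> L2norm \<Omega> r * (C * D) + L2norm \<Omega> q * D"
    unfolding D_def by (intro add_mono mult_left_mono Friedrichs d) auto
  finally have "(\<nu>l * D) * D \<le> (C * L2norm \<Omega> r + L2norm \<Omega> q) * D"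
    by (simp add: power2_eq_square algebra_simps)
  then show ?thesis using D unfolding D_def[symmetric] by simp
qed

lemma weak_solution_diff:
  assumes y: "weak_solution \<Omega> \<nu> g y" and y': "weak_solution \<Omega> \<nu> g' y'"
    and g: "g \<in> L2 \<Omega>" and g': "g' \<in> L2 \<Omega>"
  shows "weak_solution \<Omega> \<nu> (\<lambda>x. g x - g' x) (\<lambda>x. y x - y' x)"
proof -
  have H: "y \<in> H10 \<Omega>" "y' \<in> H10 \<Omega>" using y y' by (auto simp: weak_solution_iff)
  have "form (wgrad \<Omega> (\<lambda>x. y x - y' x)) (wgrad \<Omega> w) = L2inner \<Omega> (\<lambda>x. g x - g' x) w"
    if w: "w \<in> H10 \<Omega>" for w
  proof -
    have "form (wgrad \<Omega> (\<lambda>x. y x - y' x)) (wgrad \<Omega> w)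
        = form (\<lambda>x. wgrad \<Omega> y x - wgrad \<Omega> y' x) (wgrad \<Omega> w)"
      by (intro form_cong_AE H10_diff wgrad_L2 L2_diff H w)
    then show ?thesis
      using y y' w by (simp add: form_diff_left wgrad_L2 H L2inner_diff_left g g' H10_L2 weak_solution_iff)
  qed
  then show ?thesis using H10_diff(1)[OF H] by (simp add: weak_solution_iff)
qed

text \<open>Restricted to test functions, the weak equation is the definition of the weak
  divergence. Thus the exact fluxes are admissible in the majorant and annihilate its
  residuals.\<close>

lemma weak_solution_flux:
  assumes "weak_solution \<Omega> \<nu> g y" and g: "g \<in> L2 \<Omega>"
  shows "(\<lambda>x. \<nu> x *\<^sub>R wgrad \<Omega> y x) \<in> Hdiv \<Omega>"
    and "AE x in lebesgue_on \<Omega>. wdiv \<Omega> (\<lambda>x. \<nu> x *\<^sub>R wgrad \<Omega> y x) x = - g x"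
proof -
  have y: "y \<in> H10 \<Omega>" using assms by (simp add: weak_solution_iff)
  have L2: "(\<lambda>x. \<nu> x *\<^sub>R wgrad \<Omega> y x) \<in> L2 \<Omega>" by (intro \<nu>_L2 wgrad_L2 y)
  have "L2inner \<Omega> (\<lambda>x. \<nu> x *\<^sub>R wgrad \<Omega> y x) (grad \<phi>) = - L2inner \<Omega> (\<lambda>x. - g x) \<phi>"
    if \<phi>: "\<phi> \<in> test_functions \<Omega>" for \<phi>
  proof -
    have "form (wgrad \<Omega> y) (wgrad \<Omega> \<phi>) = form (wgrad \<Omega> y) (grad \<phi>)"
      unfolding form_commute[of "wgrad \<Omega> y"]
      by (intro form_cong_AE test_H10 wgrad_L2 test_grad_L2 lmeasurable_\<Omega> \<phi> y)
    then show ?thesis using assms(1) test_H10(1)[OF \<phi>]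
      by (simp add: weak_solution_iff form_def L2inner_minus_left)
  qed
  then have "has_weak_div \<Omega> (\<lambda>x. \<nu> x *\<^sub>R wgrad \<Omega> y x) (\<lambda>x. - g x)"
    unfolding has_weak_div_iff using L2_uminus[OF g] by blast
  then show "(\<lambda>x. \<nu> x *\<^sub>R wgrad \<Omega> y x) \<in> Hdiv \<Omega>"
    "AE x in lebesgue_on \<Omega>. wdiv \<Omega> (\<lambda>x. \<nu> x *\<^sub>R wgrad \<Omega> y x) x = - g x"
    using L2 wdiv_AE[OF L2] by (auto simp: Hdiv_def)
qed

section \<open>The majorant\<close>

text \<open>Here A is the norm of \<eta> - \<open>y\<^sub>d\<close>, E and D are the norms of the
  error e and of its gradient, N1 to N4 those of the four residuals; P is the inner product of
  \<eta> - \<open>y\<^sub>d\<close> with e, and I the energy product of e and \<zeta>. Then P is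
  absorbed by the three quadratic terms, and I - P by the final product.\<close>

lemma majorant_arithmetic:
  fixes A E D N1 N2 N3 N4 I P \<alpha> \<beta> lam :: real
  assumes nonneg: "0 \<le> A" "0 \<le> E" "0 \<le> D" "0 \<le> N1" "0 \<le> N2" "0 \<le> N3" "0 \<le> N4"
    and pos: "\<alpha> > 0" "\<beta> > 0" "lam > 0"
    and E: "E \<le> C * D" and D: "\<nu>l * D \<le> C * N1 + N2"
    and P: "P \<le> E * A" and PI: "- (N3 * E + N4 * D) \<le> P - I"
  shows "0 \<le> \<alpha>/2 * A\<^sup>2 + (1 + \<alpha>) * (1 + \<beta>) * C^2 / (2 * \<alpha> * \<nu>l^2) * N2\<^sup>2
    + (1 + \<alpha>) * (1 + \<beta>) * C^4 / (2 * \<alpha> * \<beta> * \<nu>l^2) * N1\<^sup>2 - I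
    + 1/\<nu>l * (C * N3 + N4) * (C^3 / (lam * \<nu>l) * N3 + C^2 / (lam * \<nu>l) * N4 + C * N1 + N2)"
proof -
  note nu = \<nu>l_pos and C = C_pos
  define S where "S = C * N1 + N2"
  define R where "R = C * N3 + N4"
  have S: "S \<ge> 0" and R: "R \<ge> 0" using nonneg C by (auto simp: S_def R_def)
  have DS: "D \<le> S / \<nu>l" using D nu by (simp add: S_def field_simps)
  have ES: "E \<le> C * S / \<nu>l"
    using E mult_left_mono[OF DS, of C] C by simp
  have "E\<^sup>2 \<le> (C * S / \<nu>l)\<^sup>2" using ES nonneg by (intro power_mono)
  \<comment> \<open>Young's inequality with weight \<beta> splits the square of S into the two
    residuals of \<tau>.\<close>
  moreover have "(1 + \<beta>) * N2\<^sup>2 + (1 + \<beta>) / \<beta> * (C * N1)\<^sup>2 - S\<^sup>2 = (\<beta> * N2 - C * N1)\<^sup>2 / \<beta>"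
    using pos by (simp add: S_def field_simps power2_eq_square)
  then have "S\<^sup>2 \<le> (1 + \<beta>) * N2\<^sup>2 + (1 + \<beta>) / \<beta> * (C * N1)\<^sup>2"
    using pos by (smt (verit) divide_nonneg_pos zero_le_power2)
  then have "(C * S / \<nu>l)\<^sup>2 \<le> C\<^sup>2 / \<nu>l\<^sup>2 * ((1 + \<beta>) * N2\<^sup>2 + (1 + \<beta>) / \<beta> * (C * N1)\<^sup>2)"
    by (simp add: power_mult_distrib power_divide mult_left_mono divide_right_mono)
  ultimately have E2: "E\<^sup>2 \<le> C\<^sup>2 / \<nu>l\<^sup>2 * ((1 + \<beta>) * N2\<^sup>2 + (1 + \<beta>) / \<beta> * (C * N1)\<^sup>2)" by linarith
  \<comment> \<open>Young's inequality alone would ask for the coefficient 1/(2 \<alpha>) of the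
    square of E; the majorant has 1/2 more, which remains as a surplus.\<close>
  have "\<alpha>/2 * A\<^sup>2 + (1 + \<alpha>) / (2 * \<alpha>) * E\<^sup>2 - E * A = (\<alpha> * A - E)\<^sup>2 / (2 * \<alpha>) + E\<^sup>2 / 2"
    using pos by (simp add: field_simps power2_eq_square)
  then have "E * A \<le> \<alpha>/2 * A\<^sup>2 + (1 + \<alpha>) / (2 * \<alpha>) * E\<^sup>2"
    using pos by (smt (verit) divide_nonneg_pos zero_le_power2)
  also have "\<dots> \<le> \<alpha>/2 * A\<^sup>2 + (1 + \<alpha>) / (2 * \<alpha>) *
      (C\<^sup>2 / \<nu>l\<^sup>2 * ((1 + \<beta>) * N2\<^sup>2 + (1 + \<beta>) / \<beta> * (C * N1)\<^sup>2))"
    using E2 pos by (intro add_left_mono mult_left_mono) auto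
  also have "\<dots> = \<alpha>/2 * A\<^sup>2 + (1 + \<alpha>) * (1 + \<beta>) * C^2 / (2 * \<alpha> * \<nu>l^2) * N2\<^sup>2
    + (1 + \<alpha>) * (1 + \<beta>) * C^4 / (2 * \<alpha> * \<beta> * \<nu>l^2) * N1\<^sup>2"
    using pos nu by (simp add: field_simps power2_eq_square power4_eq_xxxx)
  finally have 1: "P \<le> \<alpha>/2 * A\<^sup>2 + (1 + \<alpha>) * (1 + \<beta>) * C^2 / (2 * \<alpha> * \<nu>l^2) * N2\<^sup>2
    + (1 + \<alpha>) * (1 + \<beta>) * C^4 / (2 * \<alpha> * \<beta> * \<nu>l^2) * N1\<^sup>2" using P by linarith
  have "N3 * E + N4 * D \<le> N3 * (C * D) + N4 * D"
    using E nonneg by (intro add_mono mult_left_mono) auto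
  also have "\<dots> = R * D" by (simp add: R_def algebra_simps)
  also have "\<dots> \<le> R * (S / \<nu>l)" using DS R by (rule mult_left_mono)
  \<comment> \<open>The second factor of the final product is S plus a multiple of R with the weight
    1/lam, so beyond R S the product contributes only a nonnegative square.\<close>
  also have "\<dots> \<le> R * (S / \<nu>l) + 1/\<nu>l * R * (C\<^sup>2 / (lam * \<nu>l) * R)"
    using R nu pos by simp
  also have "\<dots> = 1/\<nu>l * (C * N3 + N4) * (C^3 / (lam * \<nu>l) * N3 + C^2 / (lam * \<nu>l) * N4 + C * N1 + N2)"
    using nu pos by (simp add: R_def S_def field_simps power2_eq_square power3_eq_cube)
  finally show ?thesis using 1 PI by linarith
qed

text \<open>The state y of the control v does not occur in the majorant. It enters through e = y -
  \<eta>, for which r1 and r2 are the residuals of the state equation, while r3 and r4 belong to the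
  adjoint equation.\<close>

theorem majorant_nonneg:
  assumes "\<alpha> > 0" "\<beta> > 0" "lam > 0"
    and f: "f \<in> L2 \<Omega>" and y\<^sub>d: "y\<^sub>d \<in> L2 \<Omega>" and v: "v \<in> L2 \<Omega>"
    and \<eta>: "\<eta> \<in> H10 \<Omega>" and \<zeta>: "\<zeta> \<in> H10 \<Omega>" and \<tau>: "\<tau> \<in> Hdiv \<Omega>" and \<rho>: "\<rho> \<in> Hdiv \<Omega>"
  shows "0 \<le> majorant \<Omega> \<nu> \<nu>l C lam f y\<^sub>d \<alpha> \<beta> \<eta> \<zeta> \<tau> \<rho> v"
proof -
  define r1 where "r1 = (\<lambda>x. f x + v x + wdiv \<Omega> \<tau> x)"
  define r2 where "r2 = (\<lambda>x. \<tau> x - \<nu> x *\<^sub>R wgrad \<Omega> \<eta> x)"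
  define r3 where "r3 = (\<lambda>x. \<eta> x - y\<^sub>d x + wdiv \<Omega> \<rho> x)"
  define r4 where "r4 = (\<lambda>x. \<rho> x - \<nu> x *\<^sub>R wgrad \<Omega> \<zeta> x)"
  note [simp] = f y\<^sub>d v \<eta> \<zeta> \<tau> \<rho> L2_add L2_diff \<nu>_L2 wgrad_L2 wdiv_L2 Hdiv_L2 H10_L2
  have r[simp]: "r1 \<in> L2 \<Omega>" "r2 \<in> L2 \<Omega>" "r3 \<in> L2 \<Omega>" "r4 \<in> L2 \<Omega>"
    by (simp_all add: r1_def r2_def r3_def r4_def)
  obtain y where y: "weak_solution \<Omega> \<nu> (\<lambda>x. f x + v x) y"
    using weak_solution_exists[of "\<lambda>x. f x + v x"] by auto
  have [simp]: "y \<in> H10 \<Omega>" using y by (simp add: weak_solution_iff)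
  define e where "e = (\<lambda>x. y x - \<eta> x)"
  have e[simp]: "e \<in> H10 \<Omega>" unfolding e_def by (intro H10_diff) auto
  have form_e: "form (wgrad \<Omega> e) (wgrad \<Omega> w) = L2inner \<Omega> r1 w + L2inner \<Omega> r2 (wgrad \<Omega> w)"
    if [simp]: "w \<in> H10 \<Omega>" for w
  proof -
    have "form (wgrad \<Omega> e) (wgrad \<Omega> w) = form (\<lambda>x. wgrad \<Omega> y x - wgrad \<Omega> \<eta> x) (wgrad \<Omega> w)"
      unfolding e_def by (intro form_cong_AE H10_diff wgrad_L2 L2_diff) auto
    also have "\<dots> = L2inner \<Omega> (\<lambda>x. f x + v x) w - form (wgrad \<Omega> \<eta>) (wgrad \<Omega> w)"
      using y by (simp add: form_diff_left weak_solution_iff)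
    \<comment> \<open>Green's formula for \<tau> inserts a zero that distributes the defect over r1
      and r2.\<close>
    also have "\<dots> = L2inner \<Omega> r1 w + L2inner \<Omega> r2 (wgrad \<Omega> w)"
      by (simp add: r1_def r2_def L2inner_add_left L2inner_diff_left Green_formula form_def)
    finally show ?thesis .
  qed
  define A E D where "A = L2norm \<Omega> (\<lambda>x. \<eta> x - y\<^sub>d x)" and "E = L2norm \<Omega> e"
    and "D = L2norm \<Omega> (wgrad \<Omega> e)"
  \<comment> \<open>The same with \<rho>, now tested with e: the terms containing \<rho>
    cancel.\<close>
  have dual: "L2inner \<Omega> (\<lambda>x. \<eta> x - y\<^sub>d x) e - form (wgrad \<Omega> e) (wgrad \<Omega> \<zeta>)
      = L2inner \<Omega> r3 e + L2inner \<Omega> r4 (wgrad \<Omega> e)"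
    unfolding form_commute[of "wgrad \<Omega> e"]
    by (simp add: r3_def r4_def L2inner_add_left L2inner_diff_left Green_formula form_def)
  have "0 \<le> \<alpha>/2 * A\<^sup>2 + (1 + \<alpha>) * (1 + \<beta>) * C^2 / (2 * \<alpha> * \<nu>l^2) * (L2norm \<Omega> r2)\<^sup>2
    + (1 + \<alpha>) * (1 + \<beta>) * C^4 / (2 * \<alpha> * \<beta> * \<nu>l^2) * (L2norm \<Omega> r1)\<^sup>2
    - form (wgrad \<Omega> e) (wgrad \<Omega> \<zeta>)
    + 1/\<nu>l * (C * L2norm \<Omega> r3 + L2norm \<Omega> r4) * (C^3 / (lam * \<nu>l) * L2norm \<Omega> r3
      + C^2 / (lam * \<nu>l) * L2norm \<Omega> r4 + C * L2norm \<Omega> r1 + L2norm \<Omega> r2)"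
  proof (rule majorant_arithmetic)
    show "E \<le> C * D" unfolding E_def D_def by (rule Friedrichs) simp
    show "\<nu>l * D \<le> C * L2norm \<Omega> r1 + L2norm \<Omega> r2"
      unfolding D_def by (intro energy_estimate form_e) auto
    show "L2inner \<Omega> (\<lambda>x. \<eta> x - y\<^sub>d x) e \<le> E * A"
      using L2_Cauchy_Schwarz[of "\<lambda>x. \<eta> x - y\<^sub>d x" \<Omega> e] by (simp add: A_def E_def mult.commute)
    show "- (L2norm \<Omega> r3 * E + L2norm \<Omega> r4 * D)
        \<le> L2inner \<Omega> (\<lambda>x. \<eta> x - y\<^sub>d x) e - form (wgrad \<Omega> e) (wgrad \<Omega> \<zeta>)"
      unfolding dual using L2_Cauchy_Schwarz[of r3 \<Omega> e] L2_Cauchy_Schwarz[of r4 \<Omega> "wgrad \<Omega> e"]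
      by (simp add: D_def E_def)
  qed (use assms in \<open>auto simp: A_def E_def D_def\<close>)
  then show ?thesis
    unfolding majorant_def Let_def r1_def[symmetric] r2_def[symmetric] r3_def[symmetric] r4_def[symmetric]
    by (simp add: form_e A_def L2inner_def diff_diff_eq)
qed

text \<open>The flux residuals vanish identically by the choice of the fluxes, the equilibrium
  residuals almost everywhere. The control has to equal u only almost everywhere, which covers both
  u itself and the projection of p.\<close>

lemma majorant_exact:
  assumes f: "f \<in> L2 \<Omega>" and y\<^sub>d: "y\<^sub>d \<in> L2 \<Omega>" and u: "u \<in> L2 \<Omega>" and v: "v \<in> L2 \<Omega>"
    and y: "weak_solution \<Omega> \<nu> (\<lambda>x. f x + u x) y" and p: "weak_solution \<Omega> \<nu> (\<lambda>x. y x - y\<^sub>d x) p"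
    and vu: "AE x in lebesgue_on \<Omega>. v x = u x"
  shows "majorant \<Omega> \<nu> \<nu>l C lam f y\<^sub>d \<alpha> \<beta> y p (\<lambda>x. \<nu> x *\<^sub>R wgrad \<Omega> y x) (\<lambda>x. \<nu> x *\<^sub>R wgrad \<Omega> p x) v
    = \<alpha>/2 * (L2norm \<Omega> (\<lambda>x. y x - y\<^sub>d x))\<^sup>2"
proof -
  have H: "y \<in> H10 \<Omega>" "p \<in> H10 \<Omega>" using y p by (auto simp: weak_solution_iff)
  note L2 = H10_L2[OF H(1)] H10_L2[OF H(2)]
  note flux_y = weak_solution_flux[OF y L2_add[OF f u]]
  note flux_p = weak_solution_flux[OF p L2_diff[OF L2(1) y\<^sub>d]]
  define r1 where "r1 = (\<lambda>x. f x + v x + wdiv \<Omega> (\<lambda>x. \<nu> x *\<^sub>R wgrad \<Omega> y x) x)"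
  define r3 where "r3 = (\<lambda>x. y x - y\<^sub>d x + wdiv \<Omega> (\<lambda>x. \<nu> x *\<^sub>R wgrad \<Omega> p x) x)"
  have r: "r1 \<in> L2 \<Omega>" "r3 \<in> L2 \<Omega>"
    unfolding r1_def r3_def by (intro L2_add L2_diff wdiv_L2 flux_y(1) flux_p(1) f v L2 y\<^sub>d)+
  have r1: "AE x in lebesgue_on \<Omega>. r1 x = 0"
    using flux_y(2) vu unfolding r1_def by eventually_elim simp
  have r3: "AE x in lebesgue_on \<Omega>. r3 x = 0"
    using flux_p(2) unfolding r3_def by eventually_elim simp
  have "L2norm \<Omega> r1 = 0" "L2norm \<Omega> r3 = 0"
    using L2norm_cong_AE[OF r1 r(1)] L2norm_cong_AE[OF r3 r(2)] by auto
  moreover have "(LINT x|lebesgue_on \<Omega>. r1 x * p x) = 0"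
  proof -
    have "L2inner \<Omega> r1 p = L2inner \<Omega> (\<lambda>x. 0) p" using r1 r L2 by (intro L2inner_cong_AE) auto
    then show ?thesis by (simp add: L2inner_real)
  qed
  ultimately show ?thesis
    unfolding majorant_def Let_def r1_def[symmetric] r3_def[symmetric] by simp
qed

end

section \<open>The optimal control\<close>

lemma projected_control_L2:
  assumes "u\<^sub>d \<in> L2 \<Omega>" and "u\<^sub>a \<in> L2 \<Omega>" and "u\<^sub>b \<in> L2 \<Omega>" and "\<zeta> \<in> L2 \<Omega>"
  shows "projected_control u\<^sub>d lam u\<^sub>a u\<^sub>b \<zeta> \<in> L2 \<Omega>"
proof (rule L2_dominated)
  let ?w = "\<lambda>x. u\<^sub>d x - 1/lam * \<zeta> x"
  have w: "?w \<in> L2 \<Omega>" by (intro L2_diff L2_mult assms)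
  note [measurable] = L2_measurable[OF w] assms[THEN L2_measurable]
  show "projected_control u\<^sub>d lam u\<^sub>a u\<^sub>b \<zeta> \<in> borel_measurable (lebesgue_on \<Omega>)"
    unfolding projected_control_def[abs_def] by measurable
  \<comment> \<open>At each point the projection takes one of these three values.\<close>
  show "(\<lambda>x. \<bar>u\<^sub>b x\<bar> + (\<bar>u\<^sub>a x\<bar> + \<bar>?w x\<bar>)) \<in> L2 \<Omega>"
    by (intro L2_add L2_abs w assms)
  show "AE x in lebesgue_on \<Omega>. norm (projected_control u\<^sub>d lam u\<^sub>a u\<^sub>b \<zeta> x)
      \<le> norm (\<bar>u\<^sub>b x\<bar> + (\<bar>u\<^sub>a x\<bar> + \<bar>?w x\<bar>))"
    by (intro AE_I2) (auto simp: projected_control_def min_def max_def)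
qed

lemma projected_control_admissible:
  assumes "u\<^sub>d \<in> L2 \<Omega>" and "u\<^sub>a \<in> L2 \<Omega>" and "u\<^sub>b \<in> L2 \<Omega>" and "\<zeta> \<in> L2 \<Omega>"
    and "AE x in lebesgue_on \<Omega>. u\<^sub>a x \<le> u\<^sub>b x"
  shows "projected_control u\<^sub>d lam u\<^sub>a u\<^sub>b \<zeta> \<in> admissible_controls \<Omega> u\<^sub>a u\<^sub>b"
  using projected_control_L2[OF assms(1-4)] assms(5)
  by (auto simp: admissible_controls_def projected_control_def elim!: eventually_mono)

lemma admissible_controls_convex:
  assumes u: "u \<in> admissible_controls \<Omega> u\<^sub>a u\<^sub>b" and v: "v \<in> admissible_controls \<Omega> u\<^sub>a u\<^sub>b"
    and t: "0 \<le> t" "t \<le> 1"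
  shows "(\<lambda>x. u x + t * (v x - u x)) \<in> admissible_controls \<Omega> u\<^sub>a u\<^sub>b"
proof -
  have "AE x in lebesgue_on \<Omega>. u\<^sub>a x \<le> u x \<and> u x \<le> u\<^sub>b x"
    "AE x in lebesgue_on \<Omega>. u\<^sub>a x \<le> v x \<and> v x \<le> u\<^sub>b x"
    using u v by (auto simp: admissible_controls_def)
  then have "AE x in lebesgue_on \<Omega>. u\<^sub>a x \<le> u x + t * (v x - u x) \<and> u x + t * (v x - u x) \<le> u\<^sub>b x"
  proof eventually_elim
    case (elim x)
    have "u x + t * (v x - u x) = (1 - t) * u x + t * v x" by (simp add: algebra_simps)
    moreover have "u\<^sub>a x \<le> (1 - t) * u x + t * v x" "(1 - t) * u x + t * v x \<le> u\<^sub>b x"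
      using elim t convex_bound_le[of "u x" "u\<^sub>b x" "v x" "1 - t" t]
        convex_bound_le[of "- u x" "- u\<^sub>a x" "- v x" "1 - t" t] by auto
    ultimately show ?case by simp
  qed
  then show ?thesis
    using u v by (auto simp: admissible_controls_def intro!: L2_add L2_mult L2_diff)
qed

text \<open>Divide by t and let t tend to 0: the first-order condition at an end point of a
  segment.\<close>

lemma nonneg_of_nonneg_perturbation:
  assumes "\<And>t. 0 < t \<Longrightarrow> t \<le> 1 \<Longrightarrow> 0 \<le> t * G + t\<^sup>2 * K"
  shows "(0::real) \<le> G"
proof (rule LIMSEQ_le_const)
  have "(\<lambda>n. G + inverse (real (Suc n)) * K) \<longlonglongrightarrow> G + 0 * K"
    by (intro tendsto_intros LIMSEQ_inverse_real_of_nat)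
  then show "(\<lambda>n. G + inverse (real (Suc n)) * K) \<longlonglongrightarrow> G" by simp
  have "0 \<le> G + t * K" if "0 < t" "t \<le> 1" for t
  proof -
    have "0 \<le> t * (G + t * K)"
      using assms[OF that] by (simp add: power2_eq_square algebra_simps)
    then show ?thesis using that by (simp add: zero_le_mult_iff)
  qed
  then show "\<exists>N. \<forall>n\<ge>N. 0 \<le> G + inverse (real (Suc n)) * K"
    by (simp add: inverse_le_1_iff)
qed

section \<open>First-order optimality and the projection formula\<close>

context elliptic_problem
begin

text \<open>Along the segment from u to v, the cost exceeds that of u by t G plus terms of second
  order. The adjoint equation is what expresses the slope G through p in place of the derivative of
  the state.\<close>

lemma variational_inequality:
  assumes lam: "lam > 0" and f: "f \<in> L2 \<Omega>" and y\<^sub>d: "y\<^sub>d \<in> L2 \<Omega>" and u\<^sub>d: "u\<^sub>d \<in> L2 \<Omega>"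
    and opt: "optimal_control \<Omega> \<nu> f y\<^sub>d u\<^sub>d lam u\<^sub>a u\<^sub>b u"
    and y: "weak_solution \<Omega> \<nu> (\<lambda>x. f x + u x) y" and p: "weak_solution \<Omega> \<nu> (\<lambda>x. y x - y\<^sub>d x) p"
    and v: "v \<in> admissible_controls \<Omega> u\<^sub>a u\<^sub>b"
  shows "0 \<le> L2inner \<Omega> (\<lambda>x. p x + lam * (u x - u\<^sub>d x)) (\<lambda>x. v x - u x)"
proof -
  have u: "u \<in> admissible_controls \<Omega> u\<^sub>a u\<^sub>b"
    using opt by (simp add: optimal_control_def is_arg_min_def)
  define h where "h = (\<lambda>x. v x - u x)"
  note [simp] = f y\<^sub>d u\<^sub>d L2_add L2_diff L2_mult
  have uv[simp]: "u \<in> L2 \<Omega>" "v \<in> L2 \<Omega>" using u v by (auto simp: admissible_controls_def)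
  then have h[simp]: "h \<in> L2 \<Omega>" by (simp add: h_def)
  have H: "y \<in> H10 \<Omega>" "p \<in> H10 \<Omega>" using y p by (auto simp: weak_solution_iff)
  note [simp] = H H10_L2
  define w where "w t = (\<lambda>x. u x + t * h x)" for t
  define Y where "Y t = control_state \<Omega> \<nu> f (w t)" for t
  define d where "d t = (\<lambda>x. Y t x - y x)" for t
  \<comment> \<open>\<open>c\<close> bounds the change of state per unit of t: Friedrichs'
    inequality contributes one factor C, the energy estimate C / \<nu>l.\<close>
  define c where "c = C\<^sup>2 * L2norm \<Omega> h / \<nu>l"
  define G where "G = L2inner \<Omega> (\<lambda>x. p x + lam * (u x - u\<^sub>d x)) h"
  have w_L2: "w t \<in> L2 \<Omega>" for t by (simp add: w_def)
  have Y: "weak_solution \<Omega> \<nu> (\<lambda>x. f x + w t x) (Y t)" for t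
    unfolding Y_def control_state_def using weak_solution_exists[of "\<lambda>x. f x + w t x"]
    by (intro someI_ex[where P = "weak_solution \<Omega> \<nu> (\<lambda>x. f x + w t x)"]) (simp add: w_L2)
  have d_sol: "weak_solution \<Omega> \<nu> (\<lambda>x. t * h x) (d t)" for t
    using weak_solution_diff[OF Y y, of t] by (simp add: d_def w_def)
  then have d[simp]: "d t \<in> H10 \<Omega>" for t by (simp add: weak_solution_iff)
  have d_form: "form (wgrad \<Omega> (d t)) (wgrad \<Omega> z) = t * L2inner \<Omega> h z" if "z \<in> H10 \<Omega>" for t z
    using d_sol[of t] that by (simp add: weak_solution_iff L2inner_mult_left)
  have d_small: "L2norm \<Omega> (d t) \<le> t * c" if t: "0 \<le> t" for t
  proof -
    have "\<nu>l * L2norm \<Omega> (wgrad \<Omega> (d t)) \<le> C * L2norm \<Omega> (\<lambda>x. t * h x) + L2norm \<Omega> (\<lambda>x. 0 :: real^'d)"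
      by (rule energy_estimate) (auto simp: d_form L2inner_mult_left, simp add: L2inner_def)
    then have "L2norm \<Omega> (wgrad \<Omega> (d t)) \<le> C * (t * L2norm \<Omega> h) / \<nu>l"
      using \<nu>l_pos t by (simp add: L2norm_mult field_simps)
    then have "C * L2norm \<Omega> (wgrad \<Omega> (d t)) \<le> C * (C * (t * L2norm \<Omega> h) / \<nu>l)"
      using C_pos by (intro mult_left_mono) auto
    then show ?thesis using Friedrichs[of "d t"]
      by (simp add: c_def power2_eq_square algebra_simps)
  qed
  have cost: "cost \<Omega> y\<^sub>d u\<^sub>d lam (Y t) (w t) = cost \<Omega> y\<^sub>d u\<^sub>d lam y u + t * G
      + (L2norm \<Omega> (d t))\<^sup>2 / 2 + t\<^sup>2 * (lam/2 * (L2norm \<Omega> h)\<^sup>2)" for t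
  proof -
    \<comment> \<open>The adjoint equation is tested with \<open>d t\<close>, the equation of
      \<open>d t\<close> with \<open>p\<close>; the form is symmetric.\<close>
    have "L2inner \<Omega> (\<lambda>x. y x - y\<^sub>d x) (d t) = form (wgrad \<Omega> p) (wgrad \<Omega> (d t))"
      using p by (simp add: weak_solution_iff)
    also have "\<dots> = t * L2inner \<Omega> p h"
      by (simp add: form_commute[of "wgrad \<Omega> p"] d_form L2inner_commute)
    finally have 1: "L2inner \<Omega> (\<lambda>x. y x - y\<^sub>d x) (d t) = t * L2inner \<Omega> p h" .
    have "(L2norm \<Omega> (\<lambda>x. (y x - y\<^sub>d x) + d t x))\<^sup>2
        = (L2norm \<Omega> (\<lambda>x. y x - y\<^sub>d x))\<^sup>2 + 2 * (t * L2inner \<Omega> p h) + (L2norm \<Omega> (d t))\<^sup>2"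
      using L2norm_add_power2[of "\<lambda>x. y x - y\<^sub>d x" \<Omega> "d t"] by (simp add: 1)
    moreover have "(\<lambda>x. (y x - y\<^sub>d x) + d t x) = (\<lambda>x. Y t x - y\<^sub>d x)" by (simp add: d_def)
    ultimately have 2: "(L2norm \<Omega> (\<lambda>x. Y t x - y\<^sub>d x))\<^sup>2
        = (L2norm \<Omega> (\<lambda>x. y x - y\<^sub>d x))\<^sup>2 + 2 * (t * L2inner \<Omega> p h) + (L2norm \<Omega> (d t))\<^sup>2" by simp
    have "(L2norm \<Omega> (\<lambda>x. (u x - u\<^sub>d x) + t * h x))\<^sup>2 = (L2norm \<Omega> (\<lambda>x. u x - u\<^sub>d x))\<^sup>2
        + 2 * (t * L2inner \<Omega> (\<lambda>x. u x - u\<^sub>d x) h) + t\<^sup>2 * (L2norm \<Omega> h)\<^sup>2"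
      using L2norm_add_power2[of "\<lambda>x. u x - u\<^sub>d x" \<Omega> "\<lambda>x. t * h x"]
      by (simp add: L2inner_mult_right L2norm_mult power_mult_distrib)
    moreover have "(\<lambda>x. (u x - u\<^sub>d x) + t * h x) = (\<lambda>x. w t x - u\<^sub>d x)" by (simp add: w_def algebra_simps)
    ultimately have 3: "(L2norm \<Omega> (\<lambda>x. w t x - u\<^sub>d x))\<^sup>2 = (L2norm \<Omega> (\<lambda>x. u x - u\<^sub>d x))\<^sup>2
        + 2 * (t * L2inner \<Omega> (\<lambda>x. u x - u\<^sub>d x) h) + t\<^sup>2 * (L2norm \<Omega> h)\<^sup>2" by simp
    have 4: "G = L2inner \<Omega> p h + lam * L2inner \<Omega> (\<lambda>x. u x - u\<^sub>d x) h"
      unfolding G_def by (subst L2inner_add_left) (simp_all only: L2inner_mult_left, simp_all)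
    show ?thesis unfolding cost_def 2 3 4 by (simp add: algebra_simps add_divide_distrib)
  qed
  have "0 \<le> t * G + t\<^sup>2 * (c\<^sup>2 / 2 + lam/2 * (L2norm \<Omega> h)\<^sup>2)" if t: "0 < t" "t \<le> 1" for t
  proof -
    have "w t \<in> admissible_controls \<Omega> u\<^sub>a u\<^sub>b"
      unfolding w_def h_def using t by (intro admissible_controls_convex u v) auto
    then have "cost \<Omega> y\<^sub>d u\<^sub>d lam (control_state \<Omega> \<nu> f u) u \<le> cost \<Omega> y\<^sub>d u\<^sub>d lam (Y t) (w t)"
      using opt by (auto simp: optimal_control_def is_arg_min_def Y_def not_less)
    \<comment> \<open>The chosen state \<open>Y 0\<close> may differ from \<open>y\<close> as a
      function, so the expansion is applied at t = 0 as well; the discrepancy \<open>d 0\<close>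
      only adds a nonnegative term on the favourable side.\<close>
    moreover have "control_state \<Omega> \<nu> f u = Y 0" "w 0 = u" by (simp_all add: Y_def w_def)
    ultimately have "cost \<Omega> y\<^sub>d u\<^sub>d lam (Y 0) (w 0) \<le> cost \<Omega> y\<^sub>d u\<^sub>d lam (Y t) (w t)" by simp
    then have "(L2norm \<Omega> (d 0))\<^sup>2 / 2 \<le> t * G + (L2norm \<Omega> (d t))\<^sup>2 / 2 + t\<^sup>2 * (lam/2 * (L2norm \<Omega> h)\<^sup>2)"
      unfolding cost by simp
    moreover have "(L2norm \<Omega> (d t))\<^sup>2 \<le> (t * c)\<^sup>2" using d_small t by (intro power_mono) auto
    moreover have "t\<^sup>2 * (c\<^sup>2 / 2 + lam/2 * (L2norm \<Omega> h)\<^sup>2) = (t * c)\<^sup>2 / 2 + t\<^sup>2 * (lam/2 * (L2norm \<Omega> h)\<^sup>2)"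
      by (simp add: power_mult_distrib distrib_left)
    ultimately show ?thesis using zero_le_power2[of "L2norm \<Omega> (d 0)"] by linarith
  qed
  then have "0 \<le> G" by (rule nonneg_of_nonneg_perturbation)
  then show ?thesis by (simp add: G_def h_def)
qed

text \<open>Testing the variational inequality with the projection itself suffices: pointwise,
  \<open>(v - u) (p + \<lambda>(v - u\<^sub>d)) \<le> 0\<close> for the projection \<open>v\<close> and any \<open>u \<in> [u\<^sub>a, u\<^sub>b]\<close>.\<close>

lemma optimal_control_projection:
  assumes lam: "lam > 0" and f: "f \<in> L2 \<Omega>" and y\<^sub>d: "y\<^sub>d \<in> L2 \<Omega>" and u\<^sub>d: "u\<^sub>d \<in> L2 \<Omega>"
    and u\<^sub>a: "u\<^sub>a \<in> L2 \<Omega>" and u\<^sub>b: "u\<^sub>b \<in> L2 \<Omega>" and ab: "AE x in lebesgue_on \<Omega>. u\<^sub>a x \<le> u\<^sub>b x"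
    and opt: "optimal_control \<Omega> \<nu> f y\<^sub>d u\<^sub>d lam u\<^sub>a u\<^sub>b u"
    and y: "weak_solution \<Omega> \<nu> (\<lambda>x. f x + u x) y" and p: "weak_solution \<Omega> \<nu> (\<lambda>x. y x - y\<^sub>d x) p"
  shows "AE x in lebesgue_on \<Omega>. projected_control u\<^sub>d lam u\<^sub>a u\<^sub>b p x = u x"
proof -
  define v where "v = projected_control u\<^sub>d lam u\<^sub>a u\<^sub>b p"
  have p_L2: "p \<in> L2 \<Omega>" using p by (simp add: weak_solution_iff H10_L2)
  have v: "v \<in> admissible_controls \<Omega> u\<^sub>a u\<^sub>b"
    unfolding v_def using p_L2 assms by (intro projected_control_admissible)
  then have v_L2: "v \<in> L2 \<Omega>" by (simp add: admissible_controls_def)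
  have u: "u \<in> L2 \<Omega>" "AE x in lebesgue_on \<Omega>. u\<^sub>a x \<le> u x \<and> u x \<le> u\<^sub>b x"
    using opt by (auto simp: optimal_control_def is_arg_min_def admissible_controls_def)
  define h where "h = (\<lambda>x. v x - u x)"
  have h: "h \<in> L2 \<Omega>" unfolding h_def by (intro L2_diff v_L2 u)
  have q: "(\<lambda>x. p x + lam * (u x - u\<^sub>d x)) \<in> L2 \<Omega>" by (intro L2_add L2_mult L2_diff p_L2 u u\<^sub>d)
  \<comment> \<open>Exchanging u for v inside the first factor costs exactly the term with the
    square of h. Integrated, this bounds the left side of the variational inequality by - lam times
    the squared norm of h, so h vanishes almost everywhere.\<close>
  have "AE x in lebesgue_on \<Omega>. (p x + lam * (u x - u\<^sub>d x)) * h x \<le> - lam * h x * h x"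
    using u(2)
  proof eventually_elim
    case (elim x)
    have "h x * (p x + lam * (v x - u\<^sub>d x)) \<le> 0"
    proof -
      define k where "k = u\<^sub>d x - 1/lam * p x"
      have pk: "p x + lam * (v x - u\<^sub>d x) = lam * (v x - k)"
        using lam by (simp add: k_def field_simps)
      have "v x = min (u\<^sub>b x) (max (u\<^sub>a x) k)" by (simp add: v_def projected_control_def k_def)
      then have "h x * (v x - k) \<le> 0"
        unfolding h_def using elim by (auto simp: min_def max_def mult_le_0_iff split: if_splits)
      then show ?thesis unfolding pk using lam by (simp add: mult.left_commute mult_le_0_iff)
    qed
    moreover have "(p x + lam * (u x - u\<^sub>d x)) * h x
        = h x * (p x + lam * (v x - u\<^sub>d x)) + - lam * h x * h x"
      by (simp add: h_def algebra_simps)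
    ultimately show ?case by linarith
  qed
  then have "L2inner \<Omega> (\<lambda>x. p x + lam * (u x - u\<^sub>d x)) h \<le> L2inner \<Omega> (\<lambda>x. - lam * h x) h"
    unfolding L2inner_real
    using L2_inner_integrable[OF q h] L2_inner_integrable[OF L2_mult[OF h] h]
    by (intro integral_mono_AE) auto
  also have "\<dots> = - lam * (L2norm \<Omega> h)\<^sup>2" by (simp only: L2inner_mult_left L2norm_power2)
  finally have "0 \<le> - lam * (L2norm \<Omega> h)\<^sup>2"
    using variational_inequality[OF lam f y\<^sub>d u\<^sub>d opt y p v] by (simp add: h_def)
  then have "L2norm \<Omega> h = 0" using lam by (simp add: mult_le_0_iff)
  then have "AE x in lebesgue_on \<Omega>. h x = 0" using h by (rule L2norm_eq_0_AE[rotated])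
  then show ?thesis by eventually_elim (simp add: h_def v_def)
qed

end

text \<open>If K is positive, the bound 0 need not be attained: it is the limit of the values a K as
  a tends to 0. In the extended reals the infimum exists without side conditions.\<close>

lemma INF_eq_0_of_linear_family:
  fixes F :: "'a \<Rightarrow> real"
  assumes "\<And>x. x \<in> A \<Longrightarrow> 0 \<le> F x" and "\<And>a. a > 0 \<Longrightarrow> \<exists>x\<in>A. F x = a * K"
  shows "(INF x\<in>A. ereal (F x)) = 0"
proof (rule antisym)
  show "0 \<le> (INF x\<in>A. ereal (F x))" using assms(1) by (intro INF_greatest) simp
  show "(INF x\<in>A. ereal (F x)) \<le> 0"
  proof (rule LIMSEQ_le_const)
    have "(\<lambda>n. inverse (real (Suc n)) * K) \<longlonglongrightarrow> 0 * K"
      by (intro tendsto_intros LIMSEQ_inverse_real_of_nat)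
    then show "(\<lambda>n. ereal (inverse (real (Suc n)) * K)) \<longlonglongrightarrow> 0"
      by (simp add: zero_ereal_def)
    have "(INF x\<in>A. ereal (F x)) \<le> ereal (inverse (real (Suc n)) * K)" for n
    proof -
      obtain x where "x \<in> A" "F x = inverse (real (Suc n)) * K"
        using assms(2)[of "inverse (real (Suc n))"] by auto
      then show ?thesis by (metis INF_lower)
    qed
    then show "\<exists>N. \<forall>n\<ge>N. (INF x\<in>A. ereal (F x)) \<le> ereal (inverse (real (Suc n)) * K)" by blast
  qed
qed

theorem proposition1:
  fixes \<Omega> :: "(real^'d) set"
    and \<nu> f y\<^sub>d u\<^sub>d u\<^sub>a u\<^sub>b u y p :: "real^'d \<Rightarrow> real"
    and \<nu>l \<nu>u C lam :: real
  assumes "CARD('d) \<in> {1, 2, 3}"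
    and "bounded \<Omega>" and "lipschitz_domain \<Omega>"
    and "\<nu> \<in> borel_measurable (lebesgue_on \<Omega>)"
    and "0 < \<nu>l" and "\<And>x. x \<in> \<Omega> \<Longrightarrow> \<nu>l \<le> \<nu> x \<and> \<nu> x \<le> \<nu>u"
    and "C > 0" and "\<And>w. w \<in> H10 \<Omega> \<Longrightarrow> L2norm \<Omega> w \<le> C * L2norm \<Omega> (wgrad \<Omega> w)"
    and "lam > 0"
    and "f \<in> L2 \<Omega>" and "y\<^sub>d \<in> L2 \<Omega>" and "u\<^sub>d \<in> L2 \<Omega>"
    and "u\<^sub>a \<in> L2 \<Omega>" and "u\<^sub>b \<in> L2 \<Omega>" and "AE x in lebesgue_on \<Omega>. u\<^sub>a x \<le> u\<^sub>b x"
    and "optimal_control \<Omega> \<nu> f y\<^sub>d u\<^sub>d lam u\<^sub>a u\<^sub>b u"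
    and "weak_solution \<Omega> \<nu> (\<lambda>x. f x + u x) y"
    and "weak_solution \<Omega> \<nu> (\<lambda>x. y x - y\<^sub>d x) p"
  shows "(INF (\<alpha>, \<beta>, \<eta>, \<zeta>, \<tau>, \<rho>) \<in> {0<..} \<times> {0<..} \<times> H10 \<Omega> \<times> H10 \<Omega> \<times> Hdiv \<Omega> \<times> Hdiv \<Omega>.
            ereal (majorant \<Omega> \<nu> \<nu>l C lam f y\<^sub>d \<alpha> \<beta> \<eta> \<zeta> \<tau> \<rho>
                     (projected_control u\<^sub>d lam u\<^sub>a u\<^sub>b \<zeta>))) = 0
    \<and> (AE x in lebesgue_on \<Omega>. projected_control u\<^sub>d lam u\<^sub>a u\<^sub>b p x = u x)
    \<and> (\<lambda>x. \<nu> x *\<^sub>R wgrad \<Omega> y x) \<in> Hdiv \<Omega>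
    \<and> (\<lambda>x. \<nu> x *\<^sub>R wgrad \<Omega> p x) \<in> Hdiv \<Omega>
    \<and> (INF (\<alpha>, \<beta>) \<in> {0<..} \<times> {0<..}.
            ereal (majorant \<Omega> \<nu> \<nu>l C lam f y\<^sub>d \<alpha> \<beta> y p
                     (\<lambda>x. \<nu> x *\<^sub>R wgrad \<Omega> y x) (\<lambda>x. \<nu> x *\<^sub>R wgrad \<Omega> p x) u)) = 0"
proof -
  interpret elliptic_problem \<Omega> \<nu> \<nu>l \<nu>u C
    using assms(2-8) by unfold_locales (auto simp: lipschitz_domain_def)
  note L2 = assms(10-14)
  have u: "u \<in> L2 \<Omega>"
    using assms(16) by (simp add: optimal_control_def is_arg_min_def admissible_controls_def)
  have H: "y \<in> H10 \<Omega>" "p \<in> H10 \<Omega>" using assms(17,18) by (auto simp: weak_solution_iff)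
  let ?v = "projected_control u\<^sub>d lam u\<^sub>a u\<^sub>b" and ?flux = "\<lambda>w x. \<nu> x *\<^sub>R wgrad \<Omega> w x"
  let ?K = "(L2norm \<Omega> (\<lambda>x. y x - y\<^sub>d x))\<^sup>2 / 2"
  have proj: "AE x in lebesgue_on \<Omega>. ?v p x = u x"
    using assms(9-18) by (rule optimal_control_projection)
  have v_L2: "?v \<zeta> \<in> L2 \<Omega>" if "\<zeta> \<in> H10 \<Omega>" for \<zeta>
    using projected_control_L2 L2 H10_L2[OF that] by blast
  have flux: "?flux y \<in> Hdiv \<Omega>" "?flux p \<in> Hdiv \<Omega>"
    using weak_solution_flux(1)[OF assms(17) L2_add[OF L2(1) u]]
      weak_solution_flux(1)[OF assms(18) L2_diff[OF H10_L2[OF H(1)] L2(2)]] by auto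
  \<comment> \<open>Used twice: with the projection of p for the full infimum, and with u for the
    second one.\<close>
  have exact: "majorant \<Omega> \<nu> \<nu>l C lam f y\<^sub>d \<alpha> \<beta> y p (?flux y) (?flux p) v = \<alpha> * ?K"
    if "v \<in> L2 \<Omega>" "AE x in lebesgue_on \<Omega>. v x = u x" for \<alpha> \<beta> v
    using majorant_exact[OF L2(1,2) u that(1) assms(17,18) that(2)] by simp
  have nonneg: "0 \<le> majorant \<Omega> \<nu> \<nu>l C lam f y\<^sub>d \<alpha> \<beta> \<eta> \<zeta> \<tau> \<rho> v"
    if "\<alpha> > 0" "\<beta> > 0" "\<eta> \<in> H10 \<Omega>" "\<zeta> \<in> H10 \<Omega>" "\<tau> \<in> Hdiv \<Omega>" "\<rho> \<in> Hdiv \<Omega>" "v \<in> L2 \<Omega>"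
    for \<alpha> \<beta> \<eta> \<zeta> \<tau> \<rho> v
    using that assms(9) L2 by (intro majorant_nonneg)
  have "(INF z \<in> {0<..} \<times> {0<..} \<times> H10 \<Omega> \<times> H10 \<Omega> \<times> Hdiv \<Omega> \<times> Hdiv \<Omega>.
      ereal (case z of (\<alpha>, \<beta>, \<eta>, \<zeta>, \<tau>, \<rho>) \<Rightarrow> majorant \<Omega> \<nu> \<nu>l C lam f y\<^sub>d \<alpha> \<beta> \<eta> \<zeta> \<tau> \<rho> (?v \<zeta>))) = 0"
  proof (rule INF_eq_0_of_linear_family[where K = ?K])
    fix a :: real assume "a > 0"
    then show "\<exists>z \<in> {0<..} \<times> {0<..} \<times> H10 \<Omega> \<times> H10 \<Omega> \<times> Hdiv \<Omega> \<times> Hdiv \<Omega>.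
      (case z of (\<alpha>, \<beta>, \<eta>, \<zeta>, \<tau>, \<rho>) \<Rightarrow> majorant \<Omega> \<nu> \<nu>l C lam f y\<^sub>d \<alpha> \<beta> \<eta> \<zeta> \<tau> \<rho> (?v \<zeta>)) = a * ?K"
      using exact[OF v_L2 proj] H flux
      \<comment> \<open>The value does not depend on \<beta>; 1 is one positive choice.\<close>
      by (intro bexI[of _ "(a, 1, y, p, ?flux y, ?flux p)"]) auto
  qed (auto intro!: nonneg v_L2)
  moreover have "(INF z \<in> {0<..} \<times> {0<..}. ereal (case z of (\<alpha>, \<beta>) \<Rightarrow>
      majorant \<Omega> \<nu> \<nu>l C lam f y\<^sub>d \<alpha> \<beta> y p (?flux y) (?flux p) u)) = 0"
  proof (rule INF_eq_0_of_linear_family[where K = ?K])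
    fix a :: real assume "a > 0"
    then show "\<exists>z \<in> {0<..} \<times> {0<..}. (case z of (\<alpha>, \<beta>) \<Rightarrow>
      majorant \<Omega> \<nu> \<nu>l C lam f y\<^sub>d \<alpha> \<beta> y p (?flux y) (?flux p) u) = a * ?K"
      using exact[OF u] by (intro bexI[of _ "(a, 1)"]) auto
  qed (auto intro!: nonneg u H flux)
  ultimately show ?thesis using proj flux by (simp add: case_prod_unfold)
qed

end
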